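(* Let $\lambda$ be any cardinal and let $\kappa$ be a regular (infinite) cardinal with $\kappa<\lambda$. Let $\mathrm{Set}^m_{\geqslant\lambda}$ denote the category of sets of cardinality at least $\lambda$ and monomorphisms (injective maps) between them. Then $\mathrm{Set}^m_{\geqslant\lambda}$ is not equivalent to the category of models and elementary embeddings of a theory axiomatizable in $L_{\infty,\kappa}$.
   Context: $L_{\infty,\kappa}$ is the infinitary first-order logic (with equality) over a (possibly many-sorted) small signature of function and relation symbols, whose formulas are built from atomic formulas using negation, conjunctions and disjunctions of arbitrary small sets of formulas, and universal and existential quantification over sets of fewer than $\kappa$ variables. A theory axiomatizable in $L_{\infty,\kappa}$ is given by a set of $L_{\infty,\kappa}$-sentences in some such signature. Its models are the structures in the signature satisfying these sentences, and an elementary embedding between models is a map of underlying (sorted) sets that preserves and reflects the truth of all $L_{\infty,\kappa}$-formulas of the signature. *)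

theory Defs
  imports Complex_Main "HOL-Library.FuncSet"
begin

unbundle cardinal_syntax

section \<open>The universe of small sets\<close>

text \<open>
  Sets live in a Grothendieck universe, presented by a type
  \<open>'u\<close> whose cardinality is strongly inaccessible.  The members of a Grothendieck universe \<open>U\<close>
  are exactly the subsets of \<open>U\<close> of cardinality less than that of \<open>U\<close>; accordingly a small set is a
  set of type \<open>'u set\<close> of cardinality less than \<open>|UNIV :: 'u set|\<close>, and a collection over any
  other type is called small if it is smaller than the universe.
\<close>

definition inaccessible :: "'a rel \<Rightarrow> bool" where
  "inaccessible r \<longleftrightarrow> Card_order r \<and> natLeq <o r \<and> regularCard r \<and>
     (\<forall>A :: 'a set. |A| <o r \<longrightarrow> |Pow A| <o r)"

abbreviation univ_card :: "'u itself \<Rightarrow> 'u rel" where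
  "univ_card U \<equiv> |UNIV :: 'u set|"

definition small :: "'u itself \<Rightarrow> 'a set \<Rightarrow> bool" where
  "small U A \<longleftrightarrow> |A| <o univ_card U"


section \<open>Categories and equivalences\<close>

text \<open>
  Hom-sets are indexed by objects and need not be disjoint.  Hence identities, composition and the
  arrow parts of functors take the objects involved as arguments.
\<close>

record ('o, 'm) category =
  Obj :: "'o set"
  Hom :: "'o \<Rightarrow> 'o \<Rightarrow> 'm set"
  Ident :: "'o \<Rightarrow> 'm"
  Cmp :: "'o \<Rightarrow> 'o \<Rightarrow> 'o \<Rightarrow> 'm \<Rightarrow> 'm \<Rightarrow> 'm"  \<comment> \<open>\<open>Cmp C a b c g f\<close> is \<open>g\<close> after \<open>f\<close>, for \<open>f : a \<rightarrow> b\<close>, \<open>g : b \<rightarrow> c\<close>\<close>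

definition is_category :: "('o, 'm) category \<Rightarrow> bool" where
  "is_category C \<longleftrightarrow>
     (\<forall>a\<in>Obj C. Ident C a \<in> Hom C a a) \<and>
     (\<forall>a\<in>Obj C. \<forall>b\<in>Obj C. \<forall>c\<in>Obj C. \<forall>f\<in>Hom C a b. \<forall>g\<in>Hom C b c. Cmp C a b c g f \<in> Hom C a c) \<and>
     (\<forall>a\<in>Obj C. \<forall>b\<in>Obj C. \<forall>f\<in>Hom C a b.
        Cmp C a b b (Ident C b) f = f \<and> Cmp C a a b f (Ident C a) = f) \<and>
     (\<forall>a\<in>Obj C. \<forall>b\<in>Obj C. \<forall>c\<in>Obj C. \<forall>d\<in>Obj C.
        \<forall>f\<in>Hom C a b. \<forall>g\<in>Hom C b c. \<forall>h\<in>Hom C c d.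
        Cmp C a c d h (Cmp C a b c g f) = Cmp C a b d (Cmp C b c d h g) f)"

definition is_functor ::
  "('o, 'm) category \<Rightarrow> ('p, 'n) category \<Rightarrow> ('o \<Rightarrow> 'p) \<Rightarrow> ('o \<Rightarrow> 'o \<Rightarrow> 'm \<Rightarrow> 'n) \<Rightarrow> bool" where
  "is_functor C D F\<^sub>0 F\<^sub>1 \<longleftrightarrow>
     (\<forall>a\<in>Obj C. F\<^sub>0 a \<in> Obj D) \<and>
     (\<forall>a\<in>Obj C. \<forall>b\<in>Obj C. \<forall>f\<in>Hom C a b. F\<^sub>1 a b f \<in> Hom D (F\<^sub>0 a) (F\<^sub>0 b)) \<and>
     (\<forall>a\<in>Obj C. F\<^sub>1 a a (Ident C a) = Ident D (F\<^sub>0 a)) \<and>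
     (\<forall>a\<in>Obj C. \<forall>b\<in>Obj C. \<forall>c\<in>Obj C. \<forall>f\<in>Hom C a b. \<forall>g\<in>Hom C b c.
        F\<^sub>1 a c (Cmp C a b c g f) = Cmp D (F\<^sub>0 a) (F\<^sub>0 b) (F\<^sub>0 c) (F\<^sub>1 b c g) (F\<^sub>1 a b f))"

definition is_iso :: "('o, 'm) category \<Rightarrow> 'o \<Rightarrow> 'o \<Rightarrow> 'm \<Rightarrow> bool" where
  "is_iso C a b f \<longleftrightarrow> f \<in> Hom C a b \<and>
     (\<exists>g\<in>Hom C b a. Cmp C a b a g f = Ident C a \<and> Cmp C b a b f g = Ident C b)"

definition is_nat_iso ::
  "('o, 'm) category \<Rightarrow> ('p, 'n) category \<Rightarrow> ('o \<Rightarrow> 'p) \<Rightarrow> ('o \<Rightarrow> 'o \<Rightarrow> 'm \<Rightarrow> 'n)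
     \<Rightarrow> ('o \<Rightarrow> 'p) \<Rightarrow> ('o \<Rightarrow> 'o \<Rightarrow> 'm \<Rightarrow> 'n) \<Rightarrow> ('o \<Rightarrow> 'n) \<Rightarrow> bool" where
  "is_nat_iso C D F\<^sub>0 F\<^sub>1 G\<^sub>0 G\<^sub>1 \<alpha> \<longleftrightarrow>
     (\<forall>a\<in>Obj C. is_iso D (F\<^sub>0 a) (G\<^sub>0 a) (\<alpha> a)) \<and>
     (\<forall>a\<in>Obj C. \<forall>b\<in>Obj C. \<forall>f\<in>Hom C a b.
        Cmp D (F\<^sub>0 a) (F\<^sub>0 b) (G\<^sub>0 b) (\<alpha> b) (F\<^sub>1 a b f) =
        Cmp D (F\<^sub>0 a) (G\<^sub>0 a) (G\<^sub>0 b) (G\<^sub>1 a b f) (\<alpha> a))"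

definition equivalent_categories :: "('o, 'm) category \<Rightarrow> ('p, 'n) category \<Rightarrow> bool" where
  "equivalent_categories C D \<longleftrightarrow>
     (\<exists>F\<^sub>0 F\<^sub>1 G\<^sub>0 G\<^sub>1 \<eta> \<epsilon>.
        is_functor C D F\<^sub>0 F\<^sub>1 \<and> is_functor D C G\<^sub>0 G\<^sub>1 \<and>
        is_nat_iso C C (\<lambda>a. a) (\<lambda>a b f. f) (\<lambda>a. G\<^sub>0 (F\<^sub>0 a)) (\<lambda>a b f. G\<^sub>1 (F\<^sub>0 a) (F\<^sub>0 b) (F\<^sub>1 a b f)) \<eta> \<and>
        is_nat_iso D D (\<lambda>x. F\<^sub>0 (G\<^sub>0 x)) (\<lambda>x y f. F\<^sub>1 (G\<^sub>0 x) (G\<^sub>0 y) (G\<^sub>1 x y f)) (\<lambda>x. x) (\<lambda>x y f. f) \<epsilon>)"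


section \<open>Sets of cardinality at least a given cardinal, with injections\<close>

definition set_mono_cat :: "'l rel \<Rightarrow> ('u set, 'u \<Rightarrow> 'u) category" where
  "set_mono_cat lam = \<lparr>
     Obj = {A. small TYPE('u) A \<and> lam \<le>o |A|},
     Hom = (\<lambda>A B. {f \<in> A \<rightarrow>\<^sub>E B. inj_on f A}),
     Ident = (\<lambda>A. restrict id A),
     Cmp = (\<lambda>A B C g f. compose A g f)\<rparr>"

lemma is_category_set_mono_cat: "is_category (set_mono_cat lam)"
proof -
  have "inj_on (compose A g f) A"
    if "f \<in> A \<rightarrow>\<^sub>E B" "inj_on f A" "inj_on g B" for A B :: "'a set" and f g :: "'a \<Rightarrow> 'a"
    using that by (auto simp: inj_on_def compose_def PiE_iff)
  moreover have "compose A g f \<in> A \<rightarrow>\<^sub>E C" if "f \<in> A \<rightarrow>\<^sub>E B" "g \<in> B \<rightarrow>\<^sub>E C"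
    for A B C :: "'a set" and f g :: "'a \<Rightarrow> 'a"
    using that by (auto simp: compose_def PiE_iff)
  ultimately show ?thesis
    unfolding is_category_def set_mono_cat_def
    by (auto simp: compose_def PiE_iff extensional_def fun_eq_iff)
qed


section \<open>The logic $L_{\infty,\kappa}$\<close>

text \<open>Signatures are many-sorted; operation and relation symbols have finite arities.\<close>

record ('s, 'f, 'r) signature =
  Sorts :: "'s set"
  Funs :: "'f set"
  Rels :: "'r set"
  fdom :: "'f \<Rightarrow> 's list"
  fcod :: "'f \<Rightarrow> 's"
  rdom :: "'r \<Rightarrow> 's list"

definition small_signature :: "'u itself \<Rightarrow> ('s, 'f, 'r) signature \<Rightarrow> bool" where
  "small_signature U \<Sigma> \<longleftrightarrow>
     small U (Sorts \<Sigma>) \<and> small U (Funs \<Sigma>) \<and> small U (Rels \<Sigma>) \<and>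
     (\<forall>f\<in>Funs \<Sigma>. set (fdom \<Sigma> f) \<subseteq> Sorts \<Sigma> \<and> fcod \<Sigma> f \<in> Sorts \<Sigma>) \<and>
     (\<forall>r\<in>Rels \<Sigma>. set (rdom \<Sigma> r) \<subseteq> Sorts \<Sigma>)"

text \<open>
  A variable is a pair of a sort and a name; each sort has a universe-sized supply of names.
  A small set of formulas is presented as a family indexed by a small set \<open>I\<close>;
  the values of the family outside \<open>I\<close> are irrelevant.
\<close>

type_synonym ('s, 'u) var = "'s \<times> 'u"

datatype ('s, 'f, 'u) trm =
  Var "('s, 'u) var"
| Fn 'f "('s, 'f, 'u) trm list"

datatype ('s, 'f, 'r, 'u) form =
  Eq "('s, 'f, 'u) trm" "('s, 'f, 'u) trm"
| Rel 'r "('s, 'f, 'u) trm list"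
| Neg "('s, 'f, 'r, 'u) form"
| Conj "'u set" "'u \<Rightarrow> ('s, 'f, 'r, 'u) form"
| Disj "'u set" "'u \<Rightarrow> ('s, 'f, 'r, 'u) form"
| Exi "('s, 'u) var set" "('s, 'f, 'r, 'u) form"
| Uni "('s, 'u) var set" "('s, 'f, 'r, 'u) form"

inductive has_sort :: "('s, 'f, 'r) signature \<Rightarrow> ('s, 'f, 'u) trm \<Rightarrow> 's \<Rightarrow> bool" for \<Sigma> where
  "fst x \<in> Sorts \<Sigma> \<Longrightarrow> has_sort \<Sigma> (Var x) (fst x)"
| "f \<in> Funs \<Sigma> \<Longrightarrow> list_all2 (has_sort \<Sigma>) ts (fdom \<Sigma> f) \<Longrightarrow> has_sort \<Sigma> (Fn f ts) (fcod \<Sigma> f)"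

primrec tvars :: "('s, 'f, 'u) trm \<Rightarrow> ('s, 'u) var set" where
  "tvars (Var x) = {x}"
| "tvars (Fn f ts) = \<Union> (set (map tvars ts))"

primrec free_vars :: "('s, 'f, 'r, 'u) form \<Rightarrow> ('s, 'u) var set" where
  "free_vars (Eq t u) = tvars t \<union> tvars u"
| "free_vars (Rel r ts) = \<Union> (tvars ` set ts)"
| "free_vars (Neg \<phi>) = free_vars \<phi>"
| "free_vars (Conj I \<Phi>) = (\<Union>i\<in>I. free_vars (\<Phi> i))"
| "free_vars (Disj I \<Phi>) = (\<Union>i\<in>I. free_vars (\<Phi> i))"
| "free_vars (Exi X \<phi>) = free_vars \<phi> - X"
| "free_vars (Uni X \<phi>) = free_vars \<phi> - X"

primrec wf_form :: "('s, 'f, 'r) signature \<Rightarrow> 'k rel \<Rightarrow> ('s, 'f, 'r, 'u) form \<Rightarrow> bool" where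
  "wf_form \<Sigma> \<kappa> (Eq t u) \<longleftrightarrow> (\<exists>s. has_sort \<Sigma> t s \<and> has_sort \<Sigma> u s)"
| "wf_form \<Sigma> \<kappa> (Rel r ts) \<longleftrightarrow> r \<in> Rels \<Sigma> \<and> list_all2 (has_sort \<Sigma>) ts (rdom \<Sigma> r)"
| "wf_form \<Sigma> \<kappa> (Neg \<phi>) \<longleftrightarrow> wf_form \<Sigma> \<kappa> \<phi>"
| "wf_form \<Sigma> \<kappa> (Conj I \<Phi>) \<longleftrightarrow> small TYPE('u) I \<and> (\<forall>i\<in>I. wf_form \<Sigma> \<kappa> (\<Phi> i))"
| "wf_form \<Sigma> \<kappa> (Disj I \<Phi>) \<longleftrightarrow> small TYPE('u) I \<and> (\<forall>i\<in>I. wf_form \<Sigma> \<kappa> (\<Phi> i))"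
| "wf_form \<Sigma> \<kappa> (Exi X \<phi>) \<longleftrightarrow> fst ` X \<subseteq> Sorts \<Sigma> \<and> |X| <o \<kappa> \<and> wf_form \<Sigma> \<kappa> \<phi>"
| "wf_form \<Sigma> \<kappa> (Uni X \<phi>) \<longleftrightarrow> fst ` X \<subseteq> Sorts \<Sigma> \<and> |X| <o \<kappa> \<and> wf_form \<Sigma> \<kappa> \<phi>"

text \<open>
  As usual for $L_{\infty,\kappa}$, a formula has fewer than \<open>\<kappa>\<close> free variables.  Subformulas need
  no separate bound: along the finite path from a formula to a subformula, each quantifier
  binds fewer than \<open>\<kappa>\<close> variables, and \<open>\<kappa>\<close> is infinite.  In particular the bound imposes nothing
  on sentences.  It matters for elementary embeddings: with arbitrarily many free variables
  \<open>x\<^sub>i\<close> allowed, formulas such as \<open>\<exists>y. \<And>\<^sub>i y \<noteq> x\<^sub>i\<close> would force them to be isomorphisms.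
\<close>

definition L_formula :: "('s, 'f, 'r) signature \<Rightarrow> 'k rel \<Rightarrow> ('s, 'f, 'r, 'u) form \<Rightarrow> bool" where
  "L_formula \<Sigma> \<kappa> \<phi> \<longleftrightarrow> wf_form \<Sigma> \<kappa> \<phi> \<and> |free_vars \<phi>| <o \<kappa>"

definition L_sentence :: "('s, 'f, 'r) signature \<Rightarrow> 'k rel \<Rightarrow> ('s, 'f, 'r, 'u) form \<Rightarrow> bool" where
  "L_sentence \<Sigma> \<kappa> \<phi> \<longleftrightarrow> L_formula \<Sigma> \<kappa> \<phi> \<and> free_vars \<phi> = {}"

definition L_theory :: "('s, 'f, 'r) signature \<Rightarrow> 'k rel \<Rightarrow> ('s, 'f, 'r, 'u) form set \<Rightarrow> bool" where
  "L_theory \<Sigma> \<kappa> T \<longleftrightarrow> small TYPE('u) T \<and> (\<forall>\<phi>\<in>T. L_sentence \<Sigma> \<kappa> \<phi>)"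


section \<open>Structures and satisfaction\<close>

text \<open>
  Carriers may be empty.  The components of a structure at symbols and arguments outside the
  signature are irrelevant; structures differing only there are isomorphic via the identity.
\<close>

record ('s, 'f, 'r, 'u) struct =
  Carr :: "'s \<Rightarrow> 'u set"
  finterp :: "'f \<Rightarrow> 'u list \<Rightarrow> 'u"
  rinterp :: "'r \<Rightarrow> 'u list \<Rightarrow> bool"

definition is_struct :: "('s, 'f, 'r) signature \<Rightarrow> ('s, 'f, 'r, 'u) struct \<Rightarrow> bool" where
  "is_struct \<Sigma> M \<longleftrightarrow>
     (\<forall>s\<in>Sorts \<Sigma>. small TYPE('u) (Carr M s)) \<and>
     (\<forall>f\<in>Funs \<Sigma>. \<forall>xs. list_all2 (\<lambda>x s. x \<in> Carr M s) xs (fdom \<Sigma> f)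
        \<longrightarrow> finterp M f xs \<in> Carr M (fcod \<Sigma> f))"

primrec teval :: "('s, 'f, 'r, 'u) struct \<Rightarrow> (('s, 'u) var \<Rightarrow> 'u) \<Rightarrow> ('s, 'f, 'u) trm \<Rightarrow> 'u" where
  "teval M v (Var x) = v x"
| "teval M v (Fn f ts) = finterp M f (map (teval M v) ts)"

text \<open>
  Since carriers may be empty, an assignment is only required to be well-sorted on the variables
  under consideration, and quantifiers range over well-sorted reassignments of the bound set.
\<close>

definition assignment :: "('s, 'f, 'r, 'u) struct \<Rightarrow> ('s, 'u) var set \<Rightarrow> (('s, 'u) var \<Rightarrow> 'u) \<Rightarrow> bool" where
  "assignment M X v \<longleftrightarrow> (\<forall>x\<in>X. v x \<in> Carr M (fst x))"

primrec sat :: "('s, 'f, 'r, 'u) struct \<Rightarrow> ('s, 'f, 'r, 'u) form \<Rightarrow> (('s, 'u) var \<Rightarrow> 'u) \<Rightarrow> bool" where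
  "sat M (Eq t u) = (\<lambda>v. teval M v t = teval M v u)"
| "sat M (Rel r ts) = (\<lambda>v. rinterp M r (map (teval M v) ts))"
| "sat M (Neg \<phi>) = (\<lambda>v. \<not> sat M \<phi> v)"
| "sat M (Conj I \<Phi>) = (\<lambda>v. \<forall>i\<in>I. sat M (\<Phi> i) v)"
| "sat M (Disj I \<Phi>) = (\<lambda>v. \<exists>i\<in>I. sat M (\<Phi> i) v)"
| "sat M (Exi X \<phi>) = (\<lambda>v. \<exists>w. assignment M X w \<and> (\<forall>x. x \<notin> X \<longrightarrow> w x = v x) \<and> sat M \<phi> w)"
| "sat M (Uni X \<phi>) = (\<lambda>v. \<forall>w. assignment M X w \<and> (\<forall>x. x \<notin> X \<longrightarrow> w x = v x) \<longrightarrow> sat M \<phi> w)"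

lemma teval_cong: "(\<And>x. x \<in> tvars t \<Longrightarrow> v x = w x) \<Longrightarrow> teval M v t = teval M w t"
proof (induction t)
  case (Fn f ts)
  have "teval M v t = teval M w t" if "t \<in> set ts" for t
    by (rule Fn.IH, rule that, rule Fn.prems) (use that in \<open>simp, blast\<close>)
  then have "map (teval M v) ts = map (teval M w) ts" by simp
  then show ?case by (simp only: teval.simps)
qed simp

lemma sat_cong: "(\<And>x. x \<in> free_vars \<phi> \<Longrightarrow> v x = w x) \<Longrightarrow> sat M \<phi> v = sat M \<phi> w"
proof (induction \<phi> arbitrary: v w)
  case (Eq t u)
  have "teval M v t = teval M w t" "teval M v u = teval M w u"
    by (rule teval_cong, simp add: Eq)+
  then show ?case by simp
next
  case (Rel r ts)
  have "teval M v t = teval M w t" if "t \<in> set ts" for t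
    by (rule teval_cong, rule Rel) (use that in \<open>simp, blast\<close>)
  then have "map (teval M v) ts = map (teval M w) ts" by simp
  then show ?case by (simp only: sat.simps)
next
  case (Neg \<phi>)
  have "sat M \<phi> v = sat M \<phi> w" by (rule Neg.IH) (simp add: Neg.prems)
  then show ?case by simp
next
  case (Conj I \<Phi>)
  have "sat M (\<Phi> i) v = sat M (\<Phi> i) w" if "i \<in> I" for i
    by (rule Conj.IH, simp, rule Conj.prems) (use that in \<open>simp, blast\<close>)
  then show ?case by simp
next
  case (Disj I \<Phi>)
  have "sat M (\<Phi> i) v = sat M (\<Phi> i) w" if "i \<in> I" for i
    by (rule Disj.IH, simp, rule Disj.prems) (use that in \<open>simp, blast\<close>)
  then show ?case by simp
next
  case (Exi X \<phi>)
  have "sat M (Exi X \<phi>) w" if vw: "\<And>x. x \<in> free_vars \<phi> - X \<Longrightarrow> v x = w x"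
    and s: "sat M (Exi X \<phi>) v" for v w
  proof -
    obtain v' where v': "assignment M X v'" "\<forall>x. x \<notin> X \<longrightarrow> v' x = v x" "sat M \<phi> v'"
      using s by auto
    let ?w' = "\<lambda>x. if x \<in> X then v' x else w x"
    have "sat M \<phi> v' = sat M \<phi> ?w'"
      by (rule Exi.IH) (simp add: v' vw)
    with v' have "assignment M X ?w' \<and> (\<forall>x. x \<notin> X \<longrightarrow> ?w' x = w x) \<and> sat M \<phi> ?w'"
      by (simp add: assignment_def)
    then show ?thesis unfolding sat.simps by (rule exI[of _ ?w'])
  qed
  from this[of v w] this[of w v] show ?case
    using Exi.prems unfolding free_vars.simps by metis
next
  case (Uni X \<phi>)
  have "sat M (Uni X \<phi>) w" if vw: "\<And>x. x \<in> free_vars \<phi> - X \<Longrightarrow> v x = w x"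
    and s: "sat M (Uni X \<phi>) v" for v w
    unfolding sat.simps
  proof (intro allI impI)
    fix w' assume w': "assignment M X w' \<and> (\<forall>x. x \<notin> X \<longrightarrow> w' x = w x)"
    let ?v' = "\<lambda>x. if x \<in> X then w' x else v x"
    have "sat M \<phi> ?v' = sat M \<phi> w'"
      by (rule Uni.IH) (simp add: w' vw)
    moreover have "assignment M X ?v' \<and> (\<forall>x. x \<notin> X \<longrightarrow> ?v' x = v x)"
      using w' by (simp add: assignment_def)
    ultimately show "sat M \<phi> w'" using s unfolding sat.simps by blast
  qed
  from this[of v w] this[of w v] show ?case
    using Uni.prems unfolding free_vars.simps by metis
qed

text \<open>The assignment is irrelevant in the next definition, as sentences have no free variables.\<close>

definition is_model ::
  "('s, 'f, 'r) signature \<Rightarrow> ('s, 'f, 'r, 'u) form set \<Rightarrow> ('s, 'f, 'r, 'u) struct \<Rightarrow> bool" where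
  "is_model \<Sigma> T M \<longleftrightarrow> is_struct \<Sigma> M \<and> (\<forall>\<phi>\<in>T. \<forall>v. sat M \<phi> v)"


section \<open>The category of models and elementary embeddings\<close>

text \<open>
  A map between structures is a sorted family of maps, extended by \<open>undefined\<close> outside the sorts of
  the signature and outside the carriers so that equality is pointwise equality.
\<close>

definition sorted_maps ::
  "('s, 'f, 'r) signature \<Rightarrow> ('s, 'f, 'r, 'u) struct \<Rightarrow> ('s, 'f, 'r, 'u) struct \<Rightarrow> ('s \<Rightarrow> 'u \<Rightarrow> 'u) set" where
  "sorted_maps \<Sigma> M N = (\<Pi>\<^sub>E s\<in>Sorts \<Sigma>. Carr M s \<rightarrow>\<^sub>E Carr N s)"

definition elementary_embeddings ::
  "('s, 'f, 'r) signature \<Rightarrow> 'k rel \<Rightarrow> ('s, 'f, 'r, 'u) struct \<Rightarrow> ('s, 'f, 'r, 'u) struct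
     \<Rightarrow> ('s \<Rightarrow> 'u \<Rightarrow> 'u) set" where
  "elementary_embeddings \<Sigma> \<kappa> M N = {h \<in> sorted_maps \<Sigma> M N.
     \<forall>\<phi> v. L_formula \<Sigma> \<kappa> \<phi> \<and> assignment M (free_vars \<phi>) v \<longrightarrow>
       (sat M \<phi> v \<longleftrightarrow> sat N \<phi> (\<lambda>x. h (fst x) (v x)))}"

definition model_cat ::
  "('s, 'f, 'r) signature \<Rightarrow> 'k rel \<Rightarrow> ('s, 'f, 'r, 'u) form set
     \<Rightarrow> (('s, 'f, 'r, 'u) struct, 's \<Rightarrow> 'u \<Rightarrow> 'u) category" where
  "model_cat \<Sigma> \<kappa> T = \<lparr>
     Obj = {M. is_model \<Sigma> T M},
     Hom = elementary_embeddings \<Sigma> \<kappa>,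
     Ident = (\<lambda>M. \<lambda>s\<in>Sorts \<Sigma>. restrict id (Carr M s)),
     Cmp = (\<lambda>M N P h g. \<lambda>s\<in>Sorts \<Sigma>. compose (Carr M s) (h s) (g s))\<rparr>"

lemma tvars_sorts: "has_sort \<Sigma> t s \<Longrightarrow> x \<in> tvars t \<Longrightarrow> fst x \<in> Sorts \<Sigma>"
  by (induction rule: has_sort.induct) (auto simp: list_all2_conv_all_nth in_set_conv_nth)

lemma free_vars_sorts: "wf_form \<Sigma> \<kappa> \<phi> \<Longrightarrow> x \<in> free_vars \<phi> \<Longrightarrow> fst x \<in> Sorts \<Sigma>"
proof (induction \<phi>)
  case (Rel r ts)
  then obtain t where "t \<in> set ts" "x \<in> tvars t" by auto
  moreover have "list_all2 (has_sort \<Sigma>) ts (rdom \<Sigma> r)" using Rel by simp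
  ultimately obtain s where "has_sort \<Sigma> t s"
    by (auto simp: list_all2_conv_all_nth in_set_conv_nth)
  with \<open>x \<in> tvars t\<close> show ?case by (blast intro: tvars_sorts)
qed (auto dest: tvars_sorts)

lemma is_category_model_cat: "is_category (model_cat \<Sigma> \<kappa> T)"
proof -
  let ?id = "\<lambda>M. \<lambda>s\<in>Sorts \<Sigma>. restrict id (Carr M s)"
  let ?cmp = "\<lambda>M h g. \<lambda>s\<in>Sorts \<Sigma>. compose (Carr M s) (h s) (g s)"
  have "?id M \<in> elementary_embeddings \<Sigma> \<kappa> M M" for M :: "('a, 'b, 'c, 'd) struct"
  proof -
    have "sat M \<phi> v = sat M \<phi> (\<lambda>x. ?id M (fst x) (v x))"
      if "L_formula \<Sigma> \<kappa> \<phi>" "assignment M (free_vars \<phi>) v" for \<phi> v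
      by (rule sat_cong)
        (use that free_vars_sorts[of \<Sigma> \<kappa> \<phi>] in \<open>auto simp: L_formula_def assignment_def\<close>)
    then show ?thesis by (auto simp: elementary_embeddings_def sorted_maps_def)
  qed
  moreover have "?cmp M h g \<in> elementary_embeddings \<Sigma> \<kappa> M P"
    if g: "g \<in> elementary_embeddings \<Sigma> \<kappa> M N" and h: "h \<in> elementary_embeddings \<Sigma> \<kappa> N P"
    for M N P :: "('a, 'b, 'c, 'd) struct" and g h
  proof -
    have gm: "g s x \<in> Carr N s" if "s \<in> Sorts \<Sigma>" "x \<in> Carr M s" for s x
      using g that by (auto simp: elementary_embeddings_def sorted_maps_def PiE_iff)
    have hm: "h s x \<in> Carr P s" if "s \<in> Sorts \<Sigma>" "x \<in> Carr N s" for s x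
      using h that by (auto simp: elementary_embeddings_def sorted_maps_def PiE_iff)
    have "sat M \<phi> v = sat P \<phi> (\<lambda>x. ?cmp M h g (fst x) (v x))"
      if \<phi>: "L_formula \<Sigma> \<kappa> \<phi>" and v: "assignment M (free_vars \<phi>) v" for \<phi> v
    proof -
      have S: "fst x \<in> Sorts \<Sigma>" if "x \<in> free_vars \<phi>" for x
        using that \<phi> free_vars_sorts[of \<Sigma> \<kappa> \<phi>] by (auto simp: L_formula_def)
      have gv: "assignment N (free_vars \<phi>) (\<lambda>x. g (fst x) (v x))"
        using v gm S by (auto simp: assignment_def)
      have "sat M \<phi> v = sat N \<phi> (\<lambda>x. g (fst x) (v x))"
        using g \<phi> v by (simp add: elementary_embeddings_def)
      also have "\<dots> = sat P \<phi> (\<lambda>x. h (fst x) (g (fst x) (v x)))"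
        using h \<phi> gv by (simp add: elementary_embeddings_def)
      also have "\<dots> = sat P \<phi> (\<lambda>x. ?cmp M h g (fst x) (v x))"
        by (rule sat_cong) (use S v in \<open>auto simp: assignment_def compose_def\<close>)
      finally show ?thesis .
    qed
    moreover have "?cmp M h g \<in> sorted_maps \<Sigma> M P"
      using gm hm by (auto simp: sorted_maps_def compose_def PiE_iff)
    ultimately show ?thesis by (simp add: elementary_embeddings_def)
  qed
  moreover have "?cmp M (?id N) g = g \<and> ?cmp M g (?id M) = g"
    if "g \<in> elementary_embeddings \<Sigma> \<kappa> M N" for M N :: "('a, 'b, 'c, 'd) struct" and g
  proof -
    have g: "g \<in> sorted_maps \<Sigma> M N" using that by (simp add: elementary_embeddings_def)
    have "?cmp M (?id N) g s x = g s x \<and> ?cmp M g (?id M) s x = g s x" for s x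
      using g by (cases "s \<in> Sorts \<Sigma>"; cases "x \<in> Carr M s")
        (auto simp: sorted_maps_def compose_def PiE_iff extensional_def)
    then show ?thesis by blast
  qed
  moreover have "?cmp M k (?cmp M h g) = ?cmp M (?cmp N k h) g"
    if "g \<in> elementary_embeddings \<Sigma> \<kappa> M N" for M N :: "('a, 'b, 'c, 'd) struct"
      and g and h k :: "'a \<Rightarrow> 'd \<Rightarrow> 'd"
  proof -
    have g: "g \<in> sorted_maps \<Sigma> M N" using that by (simp add: elementary_embeddings_def)
    have "?cmp M k (?cmp M h g) s x = ?cmp M (?cmp N k h) g s x" for s x
      using g by (cases "s \<in> Sorts \<Sigma>"; cases "x \<in> Carr M s")
        (auto simp: sorted_maps_def compose_def PiE_iff)
    then show ?thesis by blast
  qed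
  ultimately show ?thesis
    unfolding is_category_def model_cat_def category.simps
    by (intro conjI ballI) blast+
qed

end

theory Submission
  imports Defs
begin

text \<open>
  Let \<open>F\<close> be an equivalence. Since \<open>\<kappa>\<close>-directed unions of elementary submodels are
  elementary, every \<open>x \<in> F(A)\<close> lies in \<open>F(B \<union> S)\<close> for some \<open>|S| < \<kappa>\<close>, whatever the large set
  \<open>B \<subseteq> A\<close>. Say that \<open>D\<close> supports \<open>x\<close> if \<open>F(f)(x)\<close> depends only on the restriction of \<open>f\<close> to \<open>D\<close>.
  Supports are closed under intersection, so comparing two disjoint choices of \<open>B\<close> gives every \<open>x\<close>
  a support of size less than \<open>\<kappa>\<close>. For \<open>E \<subseteq> A\<close> of size \<open>\<kappa>\<close>, the elements with such a support inside
  \<open>E\<close> therefore form an elementary submodel, which ought to be the value of \<open>F\<close> at a set as small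
  as \<open>E\<close>, but no such set belongs to the category.
\<close>

section \<open>Equivalences are fully faithful\<close>

text \<open>By naturality \<open>K\<^sub>1 a b f\<close> determines the composite of
  \<open>f\<close> with \<open>\<eta> b\<close>, and \<open>\<eta> b\<close> has a left inverse, so
  it cancels.\<close>

lemma nat_iso_id_faithful:
  assumes C: "is_category C"
    and nat: "is_nat_iso C C (\<lambda>a. a) (\<lambda>a b f. f) K\<^sub>0 K\<^sub>1 \<eta>" and K: "\<And>a. a \<in> Obj C \<Longrightarrow> K\<^sub>0 a \<in> Obj C"
    and ab: "a \<in> Obj C" "b \<in> Obj C" and fg: "f \<in> Hom C a b" "g \<in> Hom C a b"
    and eq: "K\<^sub>1 a b f = K\<^sub>1 a b g"
  shows "f = g"
proof -
  have e: "Cmp C a b (K\<^sub>0 b) (\<eta> b) f = Cmp C a b (K\<^sub>0 b) (\<eta> b) g"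
    using nat ab fg eq unfolding is_nat_iso_def by metis
  obtain k where k: "k \<in> Hom C (K\<^sub>0 b) b" "Cmp C b (K\<^sub>0 b) b k (\<eta> b) = Ident C b"
    and \<eta>: "\<eta> b \<in> Hom C b (K\<^sub>0 b)"
    using nat ab unfolding is_nat_iso_def is_iso_def by metis
  have "h = Cmp C a (K\<^sub>0 b) b k (Cmp C a b (K\<^sub>0 b) (\<eta> b) h)" if "h \<in> Hom C a b" for h
  proof -
    have "Cmp C a (K\<^sub>0 b) b k (Cmp C a b (K\<^sub>0 b) (\<eta> b) h) = Cmp C a b b (Cmp C b (K\<^sub>0 b) b k (\<eta> b)) h"
      using C that ab K k(1) \<eta> unfolding is_category_def by blast
    also have "\<dots> = h"
      using C that ab unfolding k(2) is_category_def by blast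
    finally show ?thesis by simp
  qed
  with fg e show ?thesis by metis
qed

text \<open>The mirror image of \<open>nat_iso_id_faithful\<close>: here \<open>\<epsilon> a\<close>
  is composed on the source side and is cancelled by its right inverse.\<close>

lemma id_nat_iso_faithful:
  assumes C: "is_category C"
    and nat: "is_nat_iso C C K\<^sub>0 K\<^sub>1 (\<lambda>a. a) (\<lambda>a b f. f) \<epsilon>" and K: "\<And>a. a \<in> Obj C \<Longrightarrow> K\<^sub>0 a \<in> Obj C"
    and ab: "a \<in> Obj C" "b \<in> Obj C" and fg: "f \<in> Hom C a b" "g \<in> Hom C a b"
    and eq: "K\<^sub>1 a b f = K\<^sub>1 a b g"
  shows "f = g"
proof -
  have e: "Cmp C (K\<^sub>0 a) a b f (\<epsilon> a) = Cmp C (K\<^sub>0 a) a b g (\<epsilon> a)"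
    using nat ab fg eq unfolding is_nat_iso_def by metis
  obtain k where k: "k \<in> Hom C a (K\<^sub>0 a)" "Cmp C a (K\<^sub>0 a) a (\<epsilon> a) k = Ident C a"
    and \<epsilon>: "\<epsilon> a \<in> Hom C (K\<^sub>0 a) a"
    using nat ab unfolding is_nat_iso_def is_iso_def by metis
  have "h = Cmp C a (K\<^sub>0 a) b (Cmp C (K\<^sub>0 a) a b h (\<epsilon> a)) k" if "h \<in> Hom C a b" for h
  proof -
    have "Cmp C a (K\<^sub>0 a) b (Cmp C (K\<^sub>0 a) a b h (\<epsilon> a)) k = Cmp C a a b h (Cmp C a (K\<^sub>0 a) a (\<epsilon> a) k)"
      using C[unfolded is_category_def] that ab K k(1) \<epsilon> by metis
    also have "\<dots> = h"
      using C that ab unfolding k(2) is_category_def by blast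
    finally show ?thesis by simp
  qed
  with fg e show ?thesis by metis
qed

text \<open>Keeps of an equivalence one functor with the properties used later. Faithfulness of
  \<open>F\<close> comes from \<open>\<eta>\<close> and that of \<open>G\<close> from
  \<open>\<epsilon>\<close>; the latter is what makes \<open>F\<close> full. Essential surjectivity
  is witnessed by \<open>G\<^sub>0 x\<close> and \<open>\<epsilon> x\<close>.\<close>

lemma equivalent_categoriesE:
  assumes eqv: "equivalent_categories C D" and C: "is_category C" and D: "is_category D"
  obtains F\<^sub>0 F\<^sub>1 where "is_functor C D F\<^sub>0 F\<^sub>1"
    and "\<And>a b f g. \<lbrakk>a \<in> Obj C; b \<in> Obj C; f \<in> Hom C a b; g \<in> Hom C a b; F\<^sub>1 a b f = F\<^sub>1 a b g\<rbrakk> \<Longrightarrow> f = g"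
    and "\<And>a b h. \<lbrakk>a \<in> Obj C; b \<in> Obj C; h \<in> Hom D (F\<^sub>0 a) (F\<^sub>0 b)\<rbrakk> \<Longrightarrow> \<exists>f\<in>Hom C a b. F\<^sub>1 a b f = h"
    and "\<And>x. x \<in> Obj D \<Longrightarrow> \<exists>a\<in>Obj C. \<exists>e. is_iso D (F\<^sub>0 a) x e"
proof -
  obtain F\<^sub>0 F\<^sub>1 G\<^sub>0 G\<^sub>1 \<eta> \<epsilon> where F: "is_functor C D F\<^sub>0 F\<^sub>1" and G: "is_functor D C G\<^sub>0 G\<^sub>1"
    and \<eta>: "is_nat_iso C C (\<lambda>a. a) (\<lambda>a b f. f) (\<lambda>a. G\<^sub>0 (F\<^sub>0 a)) (\<lambda>a b f. G\<^sub>1 (F\<^sub>0 a) (F\<^sub>0 b) (F\<^sub>1 a b f)) \<eta>"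
    and \<epsilon>: "is_nat_iso D D (\<lambda>x. F\<^sub>0 (G\<^sub>0 x)) (\<lambda>x y f. F\<^sub>1 (G\<^sub>0 x) (G\<^sub>0 y) (G\<^sub>1 x y f)) (\<lambda>x. x) (\<lambda>x y f. f) \<epsilon>"
    using eqv unfolding equivalent_categories_def by blast
  have F0: "F\<^sub>0 a \<in> Obj D" if "a \<in> Obj C" for a using F that unfolding is_functor_def by blast
  have G0: "G\<^sub>0 a \<in> Obj C" if "a \<in> Obj D" for a using G that unfolding is_functor_def by blast
  have F1: "F\<^sub>1 a b f \<in> Hom D (F\<^sub>0 a) (F\<^sub>0 b)" if "a \<in> Obj C" "b \<in> Obj C" "f \<in> Hom C a b" for a b f
    using F that unfolding is_functor_def by blast
  have G1: "G\<^sub>1 a b f \<in> Hom C (G\<^sub>0 a) (G\<^sub>0 b)" if "a \<in> Obj D" "b \<in> Obj D" "f \<in> Hom D a b" for a b f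
    using G that unfolding is_functor_def by blast
  note assoc = C[unfolded is_category_def, THEN conjunct2, THEN conjunct2, THEN conjunct2, rule_format]
  note unit = C[unfolded is_category_def, THEN conjunct2, THEN conjunct2, THEN conjunct1, rule_format]
  note cmp = C[unfolded is_category_def, THEN conjunct2, THEN conjunct1, rule_format]
  have faithful: "f = g" if "a \<in> Obj C" "b \<in> Obj C" "f \<in> Hom C a b" "g \<in> Hom C a b" "F\<^sub>1 a b f = F\<^sub>1 a b g"
    for a b f g
    by (rule nat_iso_id_faithful[OF C \<eta>]) (use F0 G0 that in auto)
  have Gfaithful: "f = g" if "a \<in> Obj D" "b \<in> Obj D" "f \<in> Hom D a b" "g \<in> Hom D a b" "G\<^sub>1 a b f = G\<^sub>1 a b g"
    for a b f g
    by (rule id_nat_iso_faithful[OF D \<epsilon>]) (use F0 G0 that in auto)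
  have full: "\<exists>f\<in>Hom C a b. F\<^sub>1 a b f = h"
    if a: "a \<in> Obj C" and b: "b \<in> Obj C" and h: "h \<in> Hom D (F\<^sub>0 a) (F\<^sub>0 b)" for a b h
  proof -
    let ?a = "G\<^sub>0 (F\<^sub>0 a)" and ?b = "G\<^sub>0 (F\<^sub>0 b)"
    let ?h = "G\<^sub>1 (F\<^sub>0 a) (F\<^sub>0 b) h"
    have ab: "?a \<in> Obj C" "?b \<in> Obj C" using a b F0 G0 by auto
    have h': "?h \<in> Hom C ?a ?b" using G1 F0 a b h by blast
    obtain m where \<eta>a: "\<eta> a \<in> Hom C a ?a" and m: "m \<in> Hom C ?a a" "Cmp C ?a a ?a (\<eta> a) m = Ident C ?a"
      using \<eta> a unfolding is_nat_iso_def is_iso_def by metis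
    obtain k where \<eta>b: "\<eta> b \<in> Hom C b ?b" and k: "k \<in> Hom C ?b b" "Cmp C ?b b ?b (\<eta> b) k = Ident C ?b"
      using \<eta> b unfolding is_nat_iso_def is_iso_def by metis
    \<comment> \<open>The only possible preimage of \<open>h\<close>: naturality forces
      \<open>f\<close> to be \<open>G(h)\<close> conjugated by the components of
      \<open>\<eta>\<close>. Then \<open>G(F(f))\<close> and \<open>G(h)\<close> agree after
      \<open>\<eta> a\<close>, which is invertible, and \<open>G\<close> is faithful.\<close>
    define f where "f = Cmp C a ?b b k (Cmp C a ?a ?b ?h (\<eta> a))"
    have h\<eta>: "Cmp C a ?a ?b ?h (\<eta> a) \<in> Hom C a ?b" using cmp a ab \<eta>a h' by blast
    have f: "f \<in> Hom C a b" unfolding f_def using cmp a b ab h\<eta> k(1) by blast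
    let ?f = "G\<^sub>1 (F\<^sub>0 a) (F\<^sub>0 b) (F\<^sub>1 a b f)"
    have f': "?f \<in> Hom C ?a ?b" using F1 G1 F0 a b f by blast
    have "Cmp C a ?a ?b ?f (\<eta> a) = Cmp C a b ?b (\<eta> b) f"
      using \<eta> a b f unfolding is_nat_iso_def by metis
    also have "\<dots> = Cmp C a ?b ?b (Cmp C ?b b ?b (\<eta> b) k) (Cmp C a ?a ?b ?h (\<eta> a))"
      unfolding f_def by (rule assoc) (use a b ab h\<eta> k(1) \<eta>b in auto)
    also have "\<dots> = Cmp C a ?a ?b ?h (\<eta> a)"
      unfolding k(2) using unit a ab h\<eta> by blast
    finally have e: "Cmp C a ?a ?b ?f (\<eta> a) = Cmp C a ?a ?b ?h (\<eta> a)" .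
    have "p = Cmp C ?a a ?b (Cmp C a ?a ?b p (\<eta> a)) m" if p: "p \<in> Hom C ?a ?b" for p
    proof -
      have "p = Cmp C ?a ?a ?b p (Cmp C ?a a ?a (\<eta> a) m)"
        unfolding m(2) using unit ab p by metis
      also have "\<dots> = Cmp C ?a a ?b (Cmp C a ?a ?b p (\<eta> a)) m"
        by (rule assoc) (use a ab m(1) \<eta>a p in auto)
      finally show ?thesis .
    qed
    then have "?f = ?h" using f' h' e by metis
    then have "F\<^sub>1 a b f = h" by (intro Gfaithful) (use F0 F1 a b f h in auto)
    with f show ?thesis by blast
  qed
  have ess: "\<exists>a\<in>Obj C. \<exists>e. is_iso D (F\<^sub>0 a) x e" if "x \<in> Obj D" for x
    using \<epsilon> that G0 unfolding is_nat_iso_def by blast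
  show thesis by (rule that[OF F faithful full ess])
qed


section \<open>The Tarski--Vaught test\<close>

text \<open>A quantifier of the logic binds a set of variables, so a whole block \<open>X\<close> is
  witnessed at once. Closure of \<open>N\<close> under the operations follows from the test, see
  \<open>tarski_vaught_closed\<close>.\<close>

definition tarski_vaught ::
  "('s, 'f, 'r) signature \<Rightarrow> 'k rel \<Rightarrow> ('s, 'f, 'r, 'u) struct \<Rightarrow> ('s \<Rightarrow> 'u set) \<Rightarrow> bool" where
  "tarski_vaught \<Sigma> \<kappa> M N \<longleftrightarrow>
     (\<forall>s\<in>Sorts \<Sigma>. N s \<subseteq> Carr M s) \<and>
     (\<forall>X \<phi> v. L_formula \<Sigma> \<kappa> (Exi X \<phi>) \<and> (\<forall>x\<in>free_vars (Exi X \<phi>). v x \<in> N (fst x)) \<and> sat M (Exi X \<phi>) v \<longrightarrow>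
       (\<exists>w. (\<forall>x\<in>X. w x \<in> N (fst x)) \<and> (\<forall>x. x \<notin> X \<longrightarrow> w x = v x) \<and> sat M \<phi> w))"

lemma tarski_vaught_subset: "tarski_vaught \<Sigma> \<kappa> M N \<Longrightarrow> s \<in> Sorts \<Sigma> \<Longrightarrow> x \<in> N s \<Longrightarrow> x \<in> Carr M s"
  unfolding tarski_vaught_def by (drule conjunct1) blast

lemma tarski_vaught_witness:
  assumes "tarski_vaught \<Sigma> \<kappa> M N" "L_formula \<Sigma> \<kappa> (Exi X \<phi>)"
    and "\<And>x. x \<in> free_vars (Exi X \<phi>) \<Longrightarrow> v x \<in> N (fst x)" and "sat M (Exi X \<phi>) v"
  shows "\<exists>w. (\<forall>x\<in>X. w x \<in> N (fst x)) \<and> (\<forall>x. x \<notin> X \<longrightarrow> w x = v x) \<and> sat M \<phi> w"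
  using assms(1)[unfolded tarski_vaught_def, THEN conjunct2, rule_format, of X \<phi> v] assms(2-) by blast

lemma finite_ordLess_Cinfinite: "finite A \<Longrightarrow> Cinfinite \<kappa> \<Longrightarrow> |A| <o \<kappa>"
  by (intro Cfinite_ordLess_Cinfinite conjI card_of_Card_order) (simp_all add: cfinite_def Field_card_of)

text \<open>Removing the quantifier frees at most the variables in \<open>X\<close>, and the union
  of two sets smaller than an infinite \<open>\<kappa>\<close> is again smaller. Inductions can thus
  pass under quantifiers.\<close>

lemma L_formula_matrix:
  assumes "Cinfinite \<kappa>" "L_formula \<Sigma> \<kappa> (Exi X \<phi>)"
  shows "L_formula \<Sigma> \<kappa> \<phi>"
proof -
  have "|(free_vars \<phi> - X) \<union> X| <o \<kappa>"
    using assms by (intro Un_Cinfinite_bound_strict) (auto simp: L_formula_def)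
  moreover have "|free_vars \<phi>| \<le>o |(free_vars \<phi> - X) \<union> X|" by (rule card_of_mono1) auto
  ultimately show ?thesis
    using assms(2) by (auto simp: L_formula_def intro: ordLeq_ordLess_trans)
qed

text \<open>Shrinking the carriers changes neither the values of terms nor atomic formulas, so only
  quantifiers matter. There the test replaces a witness in \<open>M\<close> by one in
  \<open>N\<close>.\<close>

lemma sat_tarski_vaught:
  assumes \<kappa>: "Cinfinite \<kappa>" and N: "tarski_vaught \<Sigma> \<kappa> M N"
    and "L_formula \<Sigma> \<kappa> \<phi>" and "\<And>x. x \<in> free_vars \<phi> \<Longrightarrow> v x \<in> N (fst x)"
  shows "sat (M\<lparr>Carr := N\<rparr>) \<phi> v \<longleftrightarrow> sat M \<phi> v"
  using assms(3,4)
proof (induction \<phi> arbitrary: v)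
  have teval: "teval (M\<lparr>Carr := N\<rparr>) v t = teval M v t" for v t
    by (induction t) (auto intro!: arg_cong[where f = "finterp M _"])
  have teval': "teval (M\<lparr>Carr := N\<rparr>) v = teval M v" for v
    using teval by blast
  {
    case (Eq t u)
    show ?case by (simp add: teval)
  next
    case (Rel r ts)
    show ?case by (simp add: teval')
  }
next
  case (Neg \<phi>)
  then show ?case by (simp add: L_formula_def)
next
  case (Conj I \<Phi>)
  have "sat (M\<lparr>Carr := N\<rparr>) (\<Phi> i) v = sat M (\<Phi> i) v" if "i \<in> I" for i
  proof (rule Conj.IH)
    have "|free_vars (\<Phi> i)| \<le>o |free_vars (Conj I \<Phi>)|" using that by (intro card_of_mono1) auto
    then show "L_formula \<Sigma> \<kappa> (\<Phi> i)"
      using Conj.prems that by (auto simp: L_formula_def intro: ordLeq_ordLess_trans)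
  qed (use Conj.prems that in auto)
  then show ?case by simp
next
  case (Disj I \<Phi>)
  have "sat (M\<lparr>Carr := N\<rparr>) (\<Phi> i) v = sat M (\<Phi> i) v" if "i \<in> I" for i
  proof (rule Disj.IH)
    have "|free_vars (\<Phi> i)| \<le>o |free_vars (Disj I \<Phi>)|" using that by (intro card_of_mono1) auto
    then show "L_formula \<Sigma> \<kappa> (\<Phi> i)"
      using Disj.prems that by (auto simp: L_formula_def intro: ordLeq_ordLess_trans)
  qed (use Disj.prems that in auto)
  then show ?case by simp
next
  case (Exi X \<phi>)
  have L: "L_formula \<Sigma> \<kappa> \<phi>" using \<kappa> Exi.prems(1) by (rule L_formula_matrix)
  have sorts: "fst x \<in> Sorts \<Sigma>" if "x \<in> X" for x using Exi.prems(1) that by (auto simp: L_formula_def)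
  have IH: "sat (M\<lparr>Carr := N\<rparr>) \<phi> w = sat M \<phi> w"
    if "\<forall>x\<in>X. w x \<in> N (fst x)" "\<forall>x. x \<notin> X \<longrightarrow> w x = v x" for w
  proof (rule Exi.IH[OF L])
    fix x assume "x \<in> free_vars \<phi>"
    then show "w x \<in> N (fst x)" using that Exi.prems(2)[of x] by (cases "x \<in> X") (simp_all del: split_paired_All)
  qed
  show ?case
  proof
    assume "sat (M\<lparr>Carr := N\<rparr>) (Exi X \<phi>) v"
    then obtain w where w: "\<forall>x\<in>X. w x \<in> N (fst x)" "\<forall>x. x \<notin> X \<longrightarrow> w x = v x"
      and sat: "sat (M\<lparr>Carr := N\<rparr>) \<phi> w"
      unfolding sat.simps assignment_def by force
    have "assignment M X w"
      using w(1) tarski_vaught_subset[OF N sorts] unfolding assignment_def by blast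
    moreover have "sat M \<phi> w" using IH[OF w] sat by blast
    ultimately show "sat M (Exi X \<phi>) v" using w(2) unfolding sat.simps by blast
  next
    assume "sat M (Exi X \<phi>) v"
    then obtain w where w: "\<forall>x\<in>X. w x \<in> N (fst x)" "\<forall>x. x \<notin> X \<longrightarrow> w x = v x" and sat: "sat M \<phi> w"
      using tarski_vaught_witness[OF N Exi.prems(1)] Exi.prems(2) by metis
    then have "sat (M\<lparr>Carr := N\<rparr>) \<phi> w" using IH[OF w] by blast
    moreover have "assignment (M\<lparr>Carr := N\<rparr>) X w" using w(1) by (simp add: assignment_def)
    ultimately show "sat (M\<lparr>Carr := N\<rparr>) (Exi X \<phi>) v" using w(2) unfolding sat.simps by blast
  qed
next
  case (Uni X \<phi>)
  \<comment> \<open>The test speaks of \<open>Exi\<close> alone, so a universal block that fails in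
    \<open>M\<close> is treated as an existential block over the negation.\<close>
  have L': "L_formula \<Sigma> \<kappa> (Exi X (Neg \<phi>))" using Uni.prems(1) by (simp add: L_formula_def)
  then have L: "L_formula \<Sigma> \<kappa> \<phi>" using L_formula_matrix[OF \<kappa> L'] by (simp add: L_formula_def)
  have sorts: "fst x \<in> Sorts \<Sigma>" if "x \<in> X" for x using Uni.prems(1) that by (auto simp: L_formula_def)
  have IH: "sat (M\<lparr>Carr := N\<rparr>) \<phi> w = sat M \<phi> w"
    if "\<forall>x\<in>X. w x \<in> N (fst x)" "\<forall>x. x \<notin> X \<longrightarrow> w x = v x" for w
  proof (rule Uni.IH[OF L])
    fix x assume "x \<in> free_vars \<phi>"
    then show "w x \<in> N (fst x)" using that Uni.prems(2)[of x] by (cases "x \<in> X") (simp_all del: split_paired_All)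
  qed
  show ?case
  proof
    assume sat: "sat (M\<lparr>Carr := N\<rparr>) (Uni X \<phi>) v"
    show "sat M (Uni X \<phi>) v"
    proof (rule ccontr)
      assume "\<not> sat M (Uni X \<phi>) v"
      then have "sat M (Exi X (Neg \<phi>)) v" by auto
      moreover have "\<And>x. x \<in> free_vars (Exi X (Neg \<phi>)) \<Longrightarrow> v x \<in> N (fst x)" using Uni.prems(2) by simp
      ultimately obtain w where w: "\<forall>x\<in>X. w x \<in> N (fst x)" "\<forall>x. x \<notin> X \<longrightarrow> w x = v x"
        and n: "sat M (Neg \<phi>) w"
        using tarski_vaught_witness[OF N L'] by metis
      have "assignment (M\<lparr>Carr := N\<rparr>) X w" using w(1) by (simp add: assignment_def)
      then have "sat (M\<lparr>Carr := N\<rparr>) \<phi> w" using sat w(2) unfolding sat.simps by blast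
      then show False using IH[OF w] n by simp
    qed
  next
    assume sat: "sat M (Uni X \<phi>) v"
    show "sat (M\<lparr>Carr := N\<rparr>) (Uni X \<phi>) v"
      unfolding sat.simps
    proof (intro allI impI, elim conjE)
      fix w assume w: "assignment (M\<lparr>Carr := N\<rparr>) X w" "\<forall>x. x \<notin> X \<longrightarrow> w x = v x"
      have wN: "\<forall>x\<in>X. w x \<in> N (fst x)" using w(1) by (simp add: assignment_def)
      have "assignment M X w"
        using wN tarski_vaught_subset[OF N sorts] unfolding assignment_def by blast
      then have "sat M \<phi> w" using sat w(2) unfolding sat.simps by blast
      then show "sat (M\<lparr>Carr := N\<rparr>) \<phi> w" using IH[OF wN w(2)] by blast
    qed
  qed
qed

text \<open>Closure under an operation \<open>f\<close> is the test for \<open>\<exists>y. y = f(x\<^sub>0, \<dots>, x\<^sub>n\<^sub>-\<^sub>1)\<close>; the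
  injection \<open>c\<close> supplies the variable names.\<close>

lemma tarski_vaught_closed:
  fixes M :: "('s, 'f, 'r, 'u) struct"
  assumes \<kappa>: "Cinfinite \<kappa>" and N: "tarski_vaught \<Sigma> \<kappa> M N" and inf: "infinite (UNIV :: 'u set)"
    and \<Sigma>: "small_signature TYPE('u) \<Sigma>" and M: "is_struct \<Sigma> M" and f: "f \<in> Funs \<Sigma>"
    and xs: "list_all2 (\<lambda>x s. x \<in> N s) xs (fdom \<Sigma> f)"
  shows "finterp M f xs \<in> N (fcod \<Sigma> f)"
proof -
  obtain c :: "nat \<Rightarrow> 'u" where c: "inj c"
    using infinite_countable_subset[OF inf] by blast
  let ?n = "length xs"
  have len: "length (fdom \<Sigma> f) = ?n" using xs by (simp add: list_all2_lengthD)
  define var where "var = (\<lambda>i. (fdom \<Sigma> f ! i, c i))"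
  \<comment> \<open>The name \<open>c ?n\<close> differs from the names \<open>c 0\<close>, ...,
    \<open>c (?n - 1)\<close> of the arguments, so \<open>y\<close> is a new variable even if its
    sort occurs among theirs.\<close>
  define y where "y = (fcod \<Sigma> f, c ?n)"
  define ts :: "('s, 'f, 'u) trm list" where "ts = map (\<lambda>i. Var (var i)) [0..<?n]"
  let ?\<phi> = "Eq (Var y) (Fn f ts) :: ('s, 'f, 'r, 'u) form"
  \<comment> \<open>Outside \<open>y\<close> the assignment decodes the index of an argument from
    the variable name. At \<open>y\<close> it takes the value of the operation, so that
    \<open>v\<close> itself witnesses the existential formula in \<open>M\<close>.\<close>
  define v where "v = (\<lambda>x. if x = y then finterp M f xs else xs ! inv c (snd x))"
  have y: "var i \<noteq> y" if "i < ?n" for i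
    using that injD[OF c, of i ?n] by (auto simp: var_def y_def)
  have v: "v (var i) = xs ! i" if "i < ?n" for i
    using y[OF that] c by (simp add: v_def var_def)
  have sub: "set (fdom \<Sigma> f) \<subseteq> Sorts \<Sigma>" "fcod \<Sigma> f \<in> Sorts \<Sigma>"
    using \<Sigma> f by (auto simp: small_signature_def)
  have srt: "has_sort \<Sigma> (Var (s, u)) s" if "s \<in> Sorts \<Sigma>" for s and u :: 'u
    using has_sort.intros(1)[of "(s, u)" \<Sigma>] that by simp
  have "list_all2 (has_sort \<Sigma>) ts (fdom \<Sigma> f)"
    using sub(1) len by (auto simp: list_all2_conv_all_nth ts_def var_def intro!: srt)
  then have "has_sort \<Sigma> (Fn f ts) (fcod \<Sigma> f)" by (rule has_sort.intros(2)[OF f])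
  moreover have "has_sort \<Sigma> (Var y) (fcod \<Sigma> f)" unfolding y_def by (rule srt[OF sub(2)])
  moreover have "finite (free_vars (Exi {y} ?\<phi>))" by (auto simp: ts_def)
  ultimately have L: "L_formula \<Sigma> \<kappa> (Exi {y} ?\<phi>)"
    using sub(2) \<kappa> by (auto simp: L_formula_def y_def intro!: finite_ordLess_Cinfinite)
  have fv: "v x \<in> N (fst x)" if "x \<in> free_vars (Exi {y} ?\<phi>)" for x
  proof -
    from that obtain i where i: "i < ?n" "x = var i" by (auto simp: ts_def)
    then show "v x \<in> N (fst x)" using v xs by (auto simp: var_def list_all2_conv_all_nth)
  qed
  have ev: "map (teval M w) ts = xs" if "\<forall>x. x \<notin> {y} \<longrightarrow> w x = v x" for w
  proof (rule nth_equalityI)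
    fix i assume "i < length (map (teval M w) ts)"
    then have i: "i < ?n" by (simp add: ts_def)
    then have "w (var i) = xs ! i" using y[OF i] v[OF i] that[rule_format, of "var i"] by simp
    with i show "map (teval M w) ts ! i = xs ! i" by (simp add: ts_def)
  qed (simp add: ts_def)
  have "list_all2 (\<lambda>x s. x \<in> Carr M s) xs (fdom \<Sigma> f)"
    using xs N sub(1) unfolding list_all2_conv_all_nth tarski_vaught_def by (metis nth_mem subsetD)
  then have "finterp M f xs \<in> Carr M (fcod \<Sigma> f)" using M f by (simp add: is_struct_def)
  then have "sat M (Exi {y} ?\<phi>) v"
    using ev[of v] by (auto simp: assignment_def v_def y_def intro!: exI[of _ v])
  then obtain w where w: "\<forall>x\<in>{y}. w x \<in> N (fst x)" "\<forall>x. x \<notin> {y} \<longrightarrow> w x = v x" "sat M ?\<phi> w"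
    using tarski_vaught_witness[OF N L fv] by metis
  then have "w y = finterp M f xs" using ev[of w] by simp
  then show ?thesis using w(1) by (simp add: y_def)
qed

lemma tarski_vaught_model:
  fixes M :: "('s, 'f, 'r, 'u) struct"
  assumes \<kappa>: "Cinfinite \<kappa>" and N: "tarski_vaught \<Sigma> \<kappa> M N" and inf: "infinite (UNIV :: 'u set)"
    and \<Sigma>: "small_signature TYPE('u) \<Sigma>" and T: "L_theory \<Sigma> \<kappa> T" and M: "is_model \<Sigma> T M"
  shows "is_model \<Sigma> T (M\<lparr>Carr := N\<rparr>)"
proof -
  have str: "is_struct \<Sigma> M" using M by (simp add: is_model_def)
  have "small TYPE('u) (N s)" if "s \<in> Sorts \<Sigma>" for s
    using N str that card_of_mono1[of "N s" "Carr M s"]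
    by (auto simp: tarski_vaught_def is_struct_def small_def intro: ordLeq_ordLess_trans)
  then have "is_struct \<Sigma> (M\<lparr>Carr := N\<rparr>)"
    using tarski_vaught_closed[OF \<kappa> N inf \<Sigma> str] by (simp add: is_struct_def)
  moreover have "sat (M\<lparr>Carr := N\<rparr>) \<phi> v" if "\<phi> \<in> T" for \<phi> v
    using sat_tarski_vaught[OF \<kappa> N, of \<phi> v] that T M by (simp add: L_theory_def L_sentence_def is_model_def)
  ultimately show ?thesis by (simp add: is_model_def)
qed

text \<open>Truth in \<open>M\<close> and in the submodel agree at parameters from \<open>N\<close>,
  so an elementary map with values in \<open>N\<close> stays elementary when its codomain is cut
  down.\<close>

lemma elementary_into_tarski_vaught:
  assumes \<kappa>: "Cinfinite \<kappa>" and N: "tarski_vaught \<Sigma> \<kappa> M N"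
    and h: "h \<in> elementary_embeddings \<Sigma> \<kappa> P M"
    and im: "\<And>s x. s \<in> Sorts \<Sigma> \<Longrightarrow> x \<in> Carr P s \<Longrightarrow> h s x \<in> N s"
  shows "h \<in> elementary_embeddings \<Sigma> \<kappa> P (M\<lparr>Carr := N\<rparr>)"
proof -
  have "sat P \<phi> v = sat (M\<lparr>Carr := N\<rparr>) \<phi> (\<lambda>x. h (fst x) (v x))"
    if \<phi>: "L_formula \<Sigma> \<kappa> \<phi>" and v: "assignment P (free_vars \<phi>) v" for \<phi> v
  proof -
    have "sat (M\<lparr>Carr := N\<rparr>) \<phi> (\<lambda>x. h (fst x) (v x)) = sat M \<phi> (\<lambda>x. h (fst x) (v x))"
    proof (rule sat_tarski_vaught[OF \<kappa> N \<phi>])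
      fix x assume "x \<in> free_vars \<phi>"
      then show "h (fst x) (v x) \<in> N (fst x)"
        using im free_vars_sorts[of \<Sigma> \<kappa> \<phi> x] \<phi> v by (auto simp: L_formula_def assignment_def)
    qed
    with h \<phi> v show ?thesis by (simp add: elementary_embeddings_def)
  qed
  moreover have "h \<in> sorted_maps \<Sigma> P (M\<lparr>Carr := N\<rparr>)"
    using h im by (auto simp: elementary_embeddings_def sorted_maps_def PiE_iff)
  ultimately show ?thesis by (simp add: elementary_embeddings_def)
qed

lemma tarski_vaught_inclusion:
  assumes \<kappa>: "Cinfinite \<kappa>" and N: "tarski_vaught \<Sigma> \<kappa> M N"
  shows "(\<lambda>s\<in>Sorts \<Sigma>. restrict id (N s)) \<in> elementary_embeddings \<Sigma> \<kappa> (M\<lparr>Carr := N\<rparr>) M"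
proof -
  let ?i = "\<lambda>s\<in>Sorts \<Sigma>. restrict id (N s)"
  have "sat (M\<lparr>Carr := N\<rparr>) \<phi> v = sat M \<phi> (\<lambda>x. ?i (fst x) (v x))"
    if \<phi>: "L_formula \<Sigma> \<kappa> \<phi>" and v: "assignment (M\<lparr>Carr := N\<rparr>) (free_vars \<phi>) v" for \<phi> v
  proof -
    have "sat M \<phi> (\<lambda>x. ?i (fst x) (v x)) = sat M \<phi> v"
      by (rule sat_cong)
        (use \<phi> v free_vars_sorts[of \<Sigma> \<kappa> \<phi>] in \<open>auto simp: L_formula_def assignment_def\<close>)
    then show ?thesis
      using sat_tarski_vaught[OF \<kappa> N \<phi>, of v] v by (simp add: assignment_def)
  qed
  then show ?thesis
    using tarski_vaught_subset[OF N] by (simp add: elementary_embeddings_def sorted_maps_def)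
qed

text \<open>Equality of two variables is a formula of the logic, and elementary embeddings reflect
  it.\<close>

lemma elementary_embedding_inj_on:
  fixes M :: "('s, 'f, 'r, 'u) struct"
  assumes \<kappa>: "Cinfinite \<kappa>" and inf: "infinite (UNIV :: 'u set)"
    and h: "h \<in> elementary_embeddings \<Sigma> \<kappa> M N" and s: "s \<in> Sorts \<Sigma>"
  shows "inj_on (h s) (Carr M s)"
proof (rule inj_onI)
  fix x x' assume x: "x \<in> Carr M s" "x' \<in> Carr M s" "h s x = h s x'"
  obtain a b :: 'u where ab: "a \<noteq> b"
    using inf ex_new_if_finite[OF inf, of "{undefined}"] by auto
  let ?\<phi> = "Eq (Var (s, a)) (Var (s, b)) :: ('s, 'f, 'r, 'u) form"
  let ?v = "\<lambda>z. if snd z = a then x else x'"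
  have srt: "has_sort \<Sigma> (Var (s, u)) s" for u :: 'u
    using has_sort.intros(1)[of "(s, u)" \<Sigma>] s by simp
  have "L_formula \<Sigma> \<kappa> ?\<phi>"
    using \<kappa> srt by (auto simp: L_formula_def intro!: finite_ordLess_Cinfinite)
  moreover have "assignment M (free_vars ?\<phi>) ?v" using x by (auto simp: assignment_def)
  ultimately have "sat M ?\<phi> ?v = sat N ?\<phi> (\<lambda>z. h (fst z) (?v z))"
    using h unfolding elementary_embeddings_def by blast
  then show "x = x'" using x ab by auto
qed


section \<open>Elements of a model and their supports\<close>

text \<open>The situation to be refuted: a fully faithful and essentially surjective functor
  \<open>F\<close> from large sets to models.\<close>

locale sets_as_models =
  fixes \<kappa> :: "'k rel" and lam :: "'l rel" and \<Sigma> :: "('s, 'f, 'r) signature"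
    and T :: "('s, 'f, 'r, 'u) form set"
    and F\<^sub>0 :: "'u set \<Rightarrow> ('s, 'f, 'r, 'u) struct"
    and F\<^sub>1 :: "'u set \<Rightarrow> 'u set \<Rightarrow> ('u \<Rightarrow> 'u) \<Rightarrow> 's \<Rightarrow> 'u \<Rightarrow> 'u"
  assumes infinite_universe: "infinite (UNIV :: 'u set)"
    and \<kappa>: "Cinfinite \<kappa>" and regular: "regularCard \<kappa>"
    and lam: "Card_order lam" and \<kappa>_less_lam: "\<kappa> <o lam" and lam_small: "lam <o univ_card TYPE('u)"
    and \<Sigma>: "small_signature TYPE('u) \<Sigma>" and T: "L_theory \<Sigma> \<kappa> T"
    and functorial: "is_functor (set_mono_cat lam) (model_cat \<Sigma> \<kappa> T) F\<^sub>0 F\<^sub>1"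
    and faithful: "\<And>A B f g. \<lbrakk>A \<in> Obj (set_mono_cat lam); B \<in> Obj (set_mono_cat lam);
      f \<in> Hom (set_mono_cat lam) A B; g \<in> Hom (set_mono_cat lam) A B; F\<^sub>1 A B f = F\<^sub>1 A B g\<rbrakk> \<Longrightarrow> f = g"
    and full: "\<And>A B h. \<lbrakk>A \<in> Obj (set_mono_cat lam); B \<in> Obj (set_mono_cat lam);
      h \<in> Hom (model_cat \<Sigma> \<kappa> T) (F\<^sub>0 A) (F\<^sub>0 B)\<rbrakk> \<Longrightarrow> \<exists>f\<in>Hom (set_mono_cat lam) A B. F\<^sub>1 A B f = h"
    and ess_surj: "\<And>M. M \<in> Obj (model_cat \<Sigma> \<kappa> T) \<Longrightarrow>
      \<exists>A\<in>Obj (set_mono_cat lam). \<exists>e. is_iso (model_cat \<Sigma> \<kappa> T) (F\<^sub>0 A) M e"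
begin

section \<open>The functor on injections and on carriers\<close>

abbreviation sets :: "'u set set" where
  "sets \<equiv> {A. small TYPE('u) A \<and> lam \<le>o |A|}"

abbreviation inj_maps :: "'u set \<Rightarrow> 'u set \<Rightarrow> ('u \<Rightarrow> 'u) set" where
  "inj_maps A B \<equiv> {f \<in> A \<rightarrow>\<^sub>E B. inj_on f A}"

abbreviation elem :: "('s, 'f, 'r, 'u) struct \<Rightarrow> ('s, 'f, 'r, 'u) struct \<Rightarrow> ('s \<Rightarrow> 'u \<Rightarrow> 'u) set" where
  "elem \<equiv> elementary_embeddings \<Sigma> \<kappa>"

lemmas cat_simps = set_mono_cat_def model_cat_def category.simps

lemma F_model: "A \<in> sets \<Longrightarrow> is_model \<Sigma> T (F\<^sub>0 A)"
  using functorial unfolding is_functor_def cat_simps by blast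

lemma F_elem: "\<lbrakk>A \<in> sets; B \<in> sets; f \<in> inj_maps A B\<rbrakk> \<Longrightarrow> F\<^sub>1 A B f \<in> elem (F\<^sub>0 A) (F\<^sub>0 B)"
  using functorial unfolding is_functor_def cat_simps by blast

lemma elem_carrier: "h \<in> elem M N \<Longrightarrow> s \<in> Sorts \<Sigma> \<Longrightarrow> x \<in> Carr M s \<Longrightarrow> h s x \<in> Carr N s"
  by (auto simp: elementary_embeddings_def sorted_maps_def PiE_iff)

lemma elem_sat:
  "h \<in> elem M N \<Longrightarrow> L_formula \<Sigma> \<kappa> \<phi> \<Longrightarrow> assignment M (free_vars \<phi>) v \<Longrightarrow>
    sat N \<phi> (\<lambda>x. h (fst x) (v x)) = sat M \<phi> v"
  by (simp add: elementary_embeddings_def)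

lemma F_carrier:
  "\<lbrakk>A \<in> sets; B \<in> sets; f \<in> inj_maps A B; s \<in> Sorts \<Sigma>; x \<in> Carr (F\<^sub>0 A) s\<rbrakk> \<Longrightarrow> F\<^sub>1 A B f s x \<in> Carr (F\<^sub>0 B) s"
  by (rule elem_carrier[OF F_elem])

lemma F_id: "\<lbrakk>A \<in> sets; s \<in> Sorts \<Sigma>; x \<in> Carr (F\<^sub>0 A) s\<rbrakk> \<Longrightarrow> F\<^sub>1 A A (restrict id A) s x = x"
  using functorial unfolding is_functor_def cat_simps by simp

lemma F_compose:
  assumes "A \<in> sets" "B \<in> sets" "C \<in> sets" "f \<in> inj_maps A B" "g \<in> inj_maps B C"
    and "s \<in> Sorts \<Sigma>" "x \<in> Carr (F\<^sub>0 A) s"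
  shows "F\<^sub>1 A C (compose A g f) s x = F\<^sub>1 B C g s (F\<^sub>1 A B f s x)"
proof -
  have "F\<^sub>1 A C (compose A g f) = (\<lambda>s\<in>Sorts \<Sigma>. compose (Carr (F\<^sub>0 A) s) (F\<^sub>1 B C g s) (F\<^sub>1 A B f s))"
    using functorial assms(1-5) unfolding is_functor_def cat_simps by blast
  then show ?thesis using assms(6,7) by (simp add: compose_def)
qed

lemma F_inj:
  "\<lbrakk>A \<in> sets; B \<in> sets; f \<in> inj_maps A B; s \<in> Sorts \<Sigma>\<rbrakk> \<Longrightarrow> inj_on (F\<^sub>1 A B f s) (Carr (F\<^sub>0 A) s)"
  by (rule elementary_embedding_inj_on[OF \<kappa> infinite_universe F_elem])

lemma compose_inj_maps: "f \<in> inj_maps A B \<Longrightarrow> g \<in> inj_maps B C \<Longrightarrow> compose A g f \<in> inj_maps A C"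
  by (auto simp: inj_on_def compose_def PiE_iff)

lemma inclusion_inj_maps: "A \<subseteq> B \<Longrightarrow> restrict id A \<in> inj_maps A B"
  by (auto simp: inj_on_def)

lemma elem_eqI:
  assumes "h \<in> elem M N" "k \<in> elem M N" "\<And>s x. s \<in> Sorts \<Sigma> \<Longrightarrow> x \<in> Carr M s \<Longrightarrow> h s x = k s x"
  shows "h = k"
proof (intro ext)
  fix s x
  show "h s x = k s x"
    using assms by (cases "s \<in> Sorts \<Sigma>"; cases "x \<in> Carr M s")
      (auto simp: elementary_embeddings_def sorted_maps_def PiE_iff extensional_def)
qed

lemma F_faithful:
  assumes "A \<in> sets" "B \<in> sets" "f \<in> inj_maps A B" "g \<in> inj_maps A B"
    and "\<And>s x. s \<in> Sorts \<Sigma> \<Longrightarrow> x \<in> Carr (F\<^sub>0 A) s \<Longrightarrow> F\<^sub>1 A B f s x = F\<^sub>1 A B g s x"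
  shows "f = g"
  by (rule faithful[of A B]) (use assms elem_eqI[OF F_elem F_elem] in \<open>auto simp: cat_simps\<close>)

lemma sets_between: "B \<in> sets \<Longrightarrow> A \<in> sets \<Longrightarrow> B \<subseteq> D \<Longrightarrow> D \<subseteq> A \<Longrightarrow> D \<in> sets"
  using card_of_mono1[of B D] card_of_mono1[of D A]
  by (auto simp: small_def intro: ordLeq_ordLess_trans ordLeq_transitive)

text \<open>By essential surjectivity the submodel on \<open>N\<close> is isomorphic to some
  \<open>F(B)\<close>, and by fullness its inclusion becomes \<open>F(j)\<close>. If
  \<open>F(f)\<close> has values in \<open>N\<close>, composing it with the inverse isomorphism
  gives some \<open>F(l)\<close>, and faithfulness turns the resulting equation into
  \<open>f = j l\<close>. So \<open>j\<close> is universal among the injections whose image under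
  \<open>F\<close> lands in \<open>N\<close>.\<close>

lemma elementary_submodel_represented:
  assumes A: "A \<in> sets" and N: "tarski_vaught \<Sigma> \<kappa> (F\<^sub>0 A) N"
  shows "\<exists>B\<in>sets. \<exists>j\<in>inj_maps B A. (\<forall>s\<in>Sorts \<Sigma>. \<forall>x\<in>Carr (F\<^sub>0 B) s. F\<^sub>1 B A j s x \<in> N s) \<and>
    (\<forall>D\<in>sets. \<forall>f\<in>inj_maps D A. (\<forall>s\<in>Sorts \<Sigma>. \<forall>x\<in>Carr (F\<^sub>0 D) s. F\<^sub>1 D A f s x \<in> N s) \<longrightarrow>
      (\<exists>l\<in>inj_maps D B. f = compose D j l))"
proof -
  let ?M = "F\<^sub>0 A\<lparr>Carr := N\<rparr>" and ?i = "\<lambda>s\<in>Sorts \<Sigma>. restrict id (N s)"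
  let ?cmp = "\<lambda>M h g. \<lambda>s\<in>Sorts \<Sigma>. compose (Carr M s) (h s) (g s)"
  have cmp: "?cmp M h g \<in> elem M P" if "g \<in> elem M Q" "h \<in> elem Q P"
    "M \<in> Obj (model_cat \<Sigma> \<kappa> T)" "Q \<in> Obj (model_cat \<Sigma> \<kappa> T)" "P \<in> Obj (model_cat \<Sigma> \<kappa> T)" for M Q P g h
    using is_category_model_cat[of \<Sigma> \<kappa> T] that
    unfolding is_category_def model_cat_def category.simps by blast
  have M: "?M \<in> Obj (model_cat \<Sigma> \<kappa> T)"
    using tarski_vaught_model[OF \<kappa> N infinite_universe \<Sigma> T F_model[OF A]] by (simp add: model_cat_def)
  have obj: "F\<^sub>0 D \<in> Obj (model_cat \<Sigma> \<kappa> T)" if "D \<in> sets" for D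
    using F_model[OF that] by (simp add: model_cat_def)
  have i: "?i \<in> elem ?M (F\<^sub>0 A)" by (rule tarski_vaught_inclusion[OF \<kappa> N])
  obtain B e where B: "B \<in> sets" and "is_iso (model_cat \<Sigma> \<kappa> T) (F\<^sub>0 B) ?M e"
    using ess_surj[OF M] unfolding set_mono_cat_def category.simps by blast
  then obtain e' where e: "e \<in> elem (F\<^sub>0 B) ?M" and e': "e' \<in> elem ?M (F\<^sub>0 B)"
    and ee': "?cmp ?M e e' = (\<lambda>s\<in>Sorts \<Sigma>. restrict id (Carr ?M s))"
    unfolding is_iso_def model_cat_def category.simps by blast
  have ee': "e s (e' s x) = x" if "s \<in> Sorts \<Sigma>" "x \<in> N s" for s x
    using fun_cong[OF fun_cong[OF ee', of s], of x] that by (simp add: compose_def)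
  obtain j where j: "j \<in> inj_maps B A" and Fj: "F\<^sub>1 B A j = ?cmp (F\<^sub>0 B) ?i e"
    using full[of B A "?cmp (F\<^sub>0 B) ?i e"] cmp[OF e i obj[OF B] M obj[OF A]] A B
    unfolding cat_simps by blast
  have eN: "e s x \<in> N s" if "s \<in> Sorts \<Sigma>" "x \<in> Carr (F\<^sub>0 B) s" for s x
    using elem_carrier[OF e that] by simp
  have Fj: "F\<^sub>1 B A j s x = e s x" if "s \<in> Sorts \<Sigma>" "x \<in> Carr (F\<^sub>0 B) s" for s x
    unfolding Fj using that eN by (simp add: compose_def)
  have "\<exists>l\<in>inj_maps D B. f = compose D j l"
    if D: "D \<in> sets" and f: "f \<in> inj_maps D A"
      and fN: "\<And>s x. s \<in> Sorts \<Sigma> \<Longrightarrow> x \<in> Carr (F\<^sub>0 D) s \<Longrightarrow> F\<^sub>1 D A f s x \<in> N s" for D f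
  proof -
    have "F\<^sub>1 D A f \<in> elem (F\<^sub>0 D) ?M"
      by (rule elementary_into_tarski_vaught[OF \<kappa> N F_elem[OF D A f] fN])
    from cmp[OF this e' obj[OF D] M obj[OF B]] obtain l where l: "l \<in> inj_maps D B"
      and Fl: "F\<^sub>1 D B l = ?cmp (F\<^sub>0 D) e' (F\<^sub>1 D A f)"
      using full[of D B "?cmp (F\<^sub>0 D) e' (F\<^sub>1 D A f)"] D B unfolding cat_simps by blast
    have "f = compose D j l"
    proof (rule F_faithful[OF D A f compose_inj_maps[OF l j]])
      fix s x assume s: "s \<in> Sorts \<Sigma>" and x: "x \<in> Carr (F\<^sub>0 D) s"
      have "F\<^sub>1 D A (compose D j l) s x = F\<^sub>1 B A j s (F\<^sub>1 D B l s x)"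
        by (rule F_compose[OF D B A l j s x])
      also have "\<dots> = e s (F\<^sub>1 D B l s x)" by (rule Fj[OF s F_carrier[OF D B l s x]])
      also have "\<dots> = e s (e' s (F\<^sub>1 D A f s x))" using s x by (simp add: Fl compose_def)
      also have "\<dots> = F\<^sub>1 D A f s x" by (rule ee'[OF s fN[OF s x]])
      finally show "F\<^sub>1 D A f s x = F\<^sub>1 D A (compose D j l) s x" by simp
    qed
    with l show ?thesis by blast
  qed
  then show ?thesis using Fj eN by (intro bexI[OF _ B] bexI[OF _ j] conjI ballI impI) simp_all
qed

section \<open>Covering a model by \<open>\<kappa>\<close>-small enlargements of a submodel\<close>

definition im :: "'u set \<Rightarrow> 'u set \<Rightarrow> 's \<Rightarrow> 'u set" where
  "im B A s = F\<^sub>1 B A (restrict id B) s ` Carr (F\<^sub>0 B) s"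

text \<open>\<open>F\<close> of an inclusion is merely an embedding, so \<open>im B A\<close> serves
  as the copy of \<open>F(B)\<close> inside \<open>F(A)\<close>. Inclusions compose to inclusions,
  hence the embedding of \<open>F(B)\<close> factors through \<open>F(D)\<close>.\<close>

lemma im_mono:
  assumes "B \<in> sets" "D \<in> sets" "A \<in> sets" "B \<subseteq> D" "D \<subseteq> A" "s \<in> Sorts \<Sigma>"
  shows "im B A s \<subseteq> im D A s"
proof
  fix y assume "y \<in> im B A s"
  then obtain x where x: "x \<in> Carr (F\<^sub>0 B) s" "y = F\<^sub>1 B A (restrict id B) s x" by (auto simp: im_def)
  have "compose B (restrict id D) (restrict id B) = restrict id B"
    using assms(4) by (auto simp: compose_def fun_eq_iff)
  then have "y = F\<^sub>1 D A (restrict id D) s (F\<^sub>1 B D (restrict id B) s x)"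
    using F_compose[OF assms(1-3) inclusion_inj_maps[OF assms(4)] inclusion_inj_maps[OF assms(5)] assms(6) x(1)] x(2)
    by simp
  moreover have "F\<^sub>1 B D (restrict id B) s x \<in> Carr (F\<^sub>0 D) s"
    by (rule F_carrier[OF assms(1,2) inclusion_inj_maps[OF assms(4)] assms(6) x(1)])
  ultimately show "y \<in> im D A s" by (auto simp: im_def)
qed

lemma UN_ordLess: "|I| <o \<kappa> \<Longrightarrow> (\<And>i. i \<in> I \<Longrightarrow> |S i| <o \<kappa>) \<Longrightarrow> |\<Union>i\<in>I. S i| <o \<kappa>"
  using card_of_UNION_ordLess_infinite_Field_regularCard[OF regular \<kappa>] by blast

text \<open>The union of the \<open>F(B \<union> S)\<close> over \<open>|S| < \<kappa>\<close> is a \<open>\<kappa>\<close>-directed union of elementary submodels of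
  \<open>F(A)\<close>, hence of the form \<open>F(C)\<close>; every \<open>B \<union> S \<rightarrow> A\<close> factors through \<open>C \<rightarrow> A\<close>, which is
  therefore onto.\<close>

lemma carrier_covered:
  assumes A: "A \<in> sets" and B: "B \<in> sets" and BA: "B \<subseteq> A" and s: "s \<in> Sorts \<Sigma>" and x: "x \<in> Carr (F\<^sub>0 A) s"
  obtains S where "S \<subseteq> A" "|S| <o \<kappa>" "x \<in> im (B \<union> S) A s"
proof -
  define N where "N = (\<lambda>s. \<Union>S\<in>{S. S \<subseteq> A \<and> |S| <o \<kappa>}. im (B \<union> S) A s)"
  have BS: "B \<union> S \<in> sets" if "S \<subseteq> A" for S
    by (rule sets_between[OF B A]) (use that BA in auto)
  have incl: "restrict id (B \<union> S) \<in> inj_maps (B \<union> S) A" if "S \<subseteq> A" for S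
    by (rule inclusion_inj_maps) (use that BA in auto)
  have N: "tarski_vaught \<Sigma> \<kappa> (F\<^sub>0 A) N"
    unfolding tarski_vaught_def
  proof (intro conjI ballI allI impI)
    fix s assume "s \<in> Sorts \<Sigma>"
    then show "N s \<subseteq> Carr (F\<^sub>0 A) s"
      using F_carrier[OF BS A incl] unfolding N_def im_def by blast
  next
    fix X v and \<phi> :: "('s, 'f, 'r, 'u) form"
    assume *: "L_formula \<Sigma> \<kappa> (Exi X \<phi>) \<and> (\<forall>x\<in>free_vars (Exi X \<phi>). v x \<in> N (fst x)) \<and> sat (F\<^sub>0 A) (Exi X \<phi>) v"
    let ?V = "free_vars (Exi X \<phi>)"
    have L: "L_formula \<Sigma> \<kappa> (Exi X \<phi>)" and L': "L_formula \<Sigma> \<kappa> \<phi>"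
      using * L_formula_matrix[OF \<kappa>] by blast+
    have sorts: "fst x \<in> Sorts \<Sigma>" if "x \<in> ?V \<union> X" for x
      using L free_vars_sorts[of \<Sigma> \<kappa> "Exi X \<phi>" x] that by (auto simp: L_formula_def)
    have "\<forall>x\<in>?V. \<exists>S. S \<subseteq> A \<and> |S| <o \<kappa> \<and> v x \<in> im (B \<union> S) A (fst x)"
      using * unfolding N_def by blast
    then obtain S where S: "\<And>x. x \<in> ?V \<Longrightarrow> S x \<subseteq> A \<and> |S x| <o \<kappa> \<and> v x \<in> im (B \<union> S x) A (fst x)"
      by metis
    \<comment> \<open>Here directedness is used: fewer than \<open>\<kappa>\<close> parameters, each
      needing a set \<open>S x\<close> smaller than \<open>\<kappa>\<close>, all lie in the single
      submodel \<open>F(B \<union> R)\<close>, and \<open>R\<close> is smaller than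
      \<open>\<kappa>\<close> by regularity.\<close>
    define R where "R = (\<Union>x\<in>?V. S x)"
    have RA: "R \<subseteq> A" unfolding R_def using S by blast
    have R: "|R| <o \<kappa>" unfolding R_def using L S by (intro UN_ordLess) (auto simp: L_formula_def)
    let ?h = "F\<^sub>1 (B \<union> R) A (restrict id (B \<union> R))" and ?P = "F\<^sub>0 (B \<union> R)"
    have h: "?h \<in> elem ?P (F\<^sub>0 A)" by (rule F_elem[OF BS[OF RA] A incl[OF RA]])
    have "v x \<in> im (B \<union> R) A (fst x)" if "x \<in> ?V" for x
    proof -
      have sub: "S x \<subseteq> A" "B \<union> S x \<subseteq> B \<union> R" "B \<union> R \<subseteq> A"
        using S[OF that] that RA BA unfolding R_def by blast+
      have "v x \<in> im (B \<union> S x) A (fst x)" using S[OF that] by blast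
      then show ?thesis using im_mono[OF BS[OF sub(1)] BS[OF RA] A sub(2,3) sorts] that by blast
    qed
    then have "\<forall>x\<in>?V. \<exists>y\<in>Carr ?P (fst x). v x = ?h (fst x) y" unfolding im_def by blast
    then obtain u where u: "\<And>x. x \<in> ?V \<Longrightarrow> u x \<in> Carr ?P (fst x) \<and> v x = ?h (fst x) (u x)" by metis
    have "sat (F\<^sub>0 A) (Exi X \<phi>) (\<lambda>x. ?h (fst x) (u x)) = sat (F\<^sub>0 A) (Exi X \<phi>) v"
      by (rule sat_cong) (simp add: u)
    then have "sat ?P (Exi X \<phi>) u"
      using elem_sat[OF h L, of u] * u by (simp add: assignment_def)
    then obtain w where w: "assignment ?P X w" "\<forall>x. x \<notin> X \<longrightarrow> w x = u x" "sat ?P \<phi> w"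
      unfolding sat.simps by blast
    have "assignment ?P (free_vars \<phi>) w"
      unfolding assignment_def
    proof
      fix x assume "x \<in> free_vars \<phi>"
      then show "w x \<in> Carr ?P (fst x)"
        using w(1) w(2)[rule_format, of x] u[of x] unfolding assignment_def by (cases "x \<in> X") auto
    qed
    then have sat: "sat (F\<^sub>0 A) \<phi> (\<lambda>x. ?h (fst x) (w x))"
      using elem_sat[OF h L'] w(3) by blast
    \<comment> \<open>Off \<open>X\<close> the test demands \<open>v\<close> itself, whereas the
      image of \<open>w\<close> under \<open>?h\<close> is known to agree with \<open>v\<close> only
      on the free variables. By \<open>sat_cong\<close> this is enough.\<close>
    define w' where "w' = (\<lambda>x. if x \<in> X then ?h (fst x) (w x) else v x)"
    have "sat (F\<^sub>0 A) \<phi> w' = sat (F\<^sub>0 A) \<phi> (\<lambda>x. ?h (fst x) (w x))"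
    proof (rule sat_cong)
      fix x assume "x \<in> free_vars \<phi>"
      then show "w' x = ?h (fst x) (w x)"
        using u[of x] w(2)[rule_format, of x] by (cases "x \<in> X") (auto simp: w'_def)
    qed
    with sat have "sat (F\<^sub>0 A) \<phi> w'" by blast
    moreover have "\<forall>x\<in>X. w' x \<in> N (fst x)"
    proof
      fix x assume x: "x \<in> X"
      then have "w' x \<in> im (B \<union> R) A (fst x)" using w(1) by (simp add: w'_def im_def assignment_def)
      then show "w' x \<in> N (fst x)" using RA R unfolding N_def by blast
    qed
    ultimately show "\<exists>w. (\<forall>x\<in>X. w x \<in> N (fst x)) \<and> (\<forall>x. x \<notin> X \<longrightarrow> w x = v x) \<and> sat (F\<^sub>0 A) \<phi> w"
      by (intro exI[of _ w']) (simp add: w'_def)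
  qed
  obtain C j where C: "C \<in> sets" and j: "j \<in> inj_maps C A"
    and jN: "\<forall>s\<in>Sorts \<Sigma>. \<forall>x\<in>Carr (F\<^sub>0 C) s. F\<^sub>1 C A j s x \<in> N s"
    and factor: "\<forall>D\<in>sets. \<forall>f\<in>inj_maps D A. (\<forall>s\<in>Sorts \<Sigma>. \<forall>x\<in>Carr (F\<^sub>0 D) s. F\<^sub>1 D A f s x \<in> N s) \<longrightarrow>
      (\<exists>l\<in>inj_maps D C. f = compose D j l)"
    using elementary_submodel_represented[OF A N] by (elim bexE conjE)
  have "a \<in> j ` C" if a: "a \<in> A" for a
  proof -
    have aA: "{a} \<subseteq> A" using a by simp
    have "|{a}| <o \<kappa>" by (rule finite_ordLess_Cinfinite) (use \<kappa> in auto)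
    then have "\<forall>s\<in>Sorts \<Sigma>. \<forall>x\<in>Carr (F\<^sub>0 (B \<union> {a})) s. F\<^sub>1 (B \<union> {a}) A (restrict id (B \<union> {a})) s x \<in> N s"
      using aA unfolding N_def im_def by blast
    then obtain l where l: "l \<in> inj_maps (B \<union> {a}) C" "restrict id (B \<union> {a}) = compose (B \<union> {a}) j l"
      using factor BS[OF aA] incl[OF aA] by meson
    have "a = j (l a)" using fun_cong[OF l(2), of a] by (simp add: compose_def)
    moreover have "l a \<in> C" using l(1) by (auto simp: PiE_iff)
    ultimately show ?thesis by blast
  qed
  then have jA: "j ` C = A" using j by (auto simp: PiE_iff)
  \<comment> \<open>Being a bijection, \<open>j\<close> has an inverse in the category, so
    \<open>F(j)\<close> is onto and every element of \<open>F(A)\<close> lies in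
    \<open>N\<close>.\<close>
  define g where "g = restrict (inv_into C j) A"
  have g: "g \<in> inj_maps A C"
    using inj_on_inv_into[of A j C] jA inv_into_into[of _ j C] by (simp add: g_def)
  have jg: "compose A j g = restrict id A"
    using jA f_inv_into_f[of _ j C] by (simp add: compose_def g_def fun_eq_iff)
  have "x = F\<^sub>1 C A j s (F\<^sub>1 A C g s x)"
    using F_compose[OF A C A g j s x] F_id[OF A s x] jg by simp
  then have "x \<in> N s" using jN s F_carrier[OF A C g s x] by metis
  then show thesis using that unfolding N_def by blast
qed

section \<open>Supports of elements\<close>

definition supports :: "'u set \<Rightarrow> 'u set \<Rightarrow> 's \<Rightarrow> 'u \<Rightarrow> bool" where
  "supports A D s x \<longleftrightarrow> (\<forall>A'\<in>sets. \<forall>f\<in>inj_maps A A'. \<forall>g\<in>inj_maps A A'.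
     (\<forall>a\<in>A \<inter> D. f a = g a) \<longrightarrow> F\<^sub>1 A A' f s x = F\<^sub>1 A A' g s x)"

lemma supportsD:
  "\<lbrakk>supports A D s x; A' \<in> sets; f \<in> inj_maps A A'; g \<in> inj_maps A A'; \<And>a. a \<in> A \<Longrightarrow> a \<in> D \<Longrightarrow> f a = g a\<rbrakk>
    \<Longrightarrow> F\<^sub>1 A A' f s x = F\<^sub>1 A A' g s x"
  unfolding supports_def by blast

lemma supports_mono: "supports A C s x \<Longrightarrow> C \<subseteq> D \<Longrightarrow> supports A D s x"
  unfolding supports_def by blast

text \<open>An element coming from \<open>F(B)\<close> sees an injection out of \<open>A\<close>
  only through its composite with the inclusion of \<open>B\<close>.\<close>

lemma supports_im:
  assumes A: "A \<in> sets" and B: "B \<in> sets" "B \<subseteq> A" and s: "s \<in> Sorts \<Sigma>" and x: "x \<in> im B A s"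
  shows "supports A B s x"
  unfolding supports_def
proof (intro ballI impI)
  fix A' f g
  assume A': "A' \<in> sets" and f: "f \<in> inj_maps A A'" and g: "g \<in> inj_maps A A'" and fg: "\<forall>a\<in>A \<inter> B. f a = g a"
  obtain y where y: "y \<in> Carr (F\<^sub>0 B) s" "x = F\<^sub>1 B A (restrict id B) s y" using x by (auto simp: im_def)
  note i = inclusion_inj_maps[OF B(2)]
  have "compose B f (restrict id B) = compose B g (restrict id B)"
    using fg B by (auto simp: compose_def fun_eq_iff)
  then show "F\<^sub>1 A A' f s x = F\<^sub>1 A A' g s x"
    using F_compose[OF B(1) A A' i f s y(1)] F_compose[OF B(1) A A' i g s y(1)] y(2) by simp
qed

text \<open>If \<open>f\<close> and \<open>g\<close> agree on the image of \<open>D\<close> under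
  \<open>h\<close>, their composites with \<open>h\<close> agree on \<open>D\<close>. This is how
  supports are moved along injections later.\<close>

lemma supports_image:
  assumes A: "A \<in> sets" and x: "s \<in> Sorts \<Sigma>" "x \<in> Carr (F\<^sub>0 A) s" and D: "supports A D s x"
    and h: "h \<in> inj_maps A A"
  shows "supports A (h ` D) s (F\<^sub>1 A A h s x)"
  unfolding supports_def
proof (intro ballI impI)
  fix A' f g
  assume A': "A' \<in> sets" and f: "f \<in> inj_maps A A'" and g: "g \<in> inj_maps A A'" and fg: "\<forall>a\<in>A \<inter> h ` D. f a = g a"
  have "F\<^sub>1 A A' (compose A f h) s x = F\<^sub>1 A A' (compose A g h) s x"
    by (rule supportsD[OF D A' compose_inj_maps[OF h f] compose_inj_maps[OF h g]])
      (use fg h in \<open>auto simp: compose_def PiE_iff\<close>)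
  then show "F\<^sub>1 A A' f s (F\<^sub>1 A A h s x) = F\<^sub>1 A A' g s (F\<^sub>1 A A h s x)"
    using F_compose[OF A A A' h f x] F_compose[OF A A A' h g x] by simp
qed

text \<open>With a disjoint copy \<open>p ` A\<close> of \<open>A\<close> adjoined to the target, an injection can be changed to \<open>p\<close> off \<open>C\<close>,
  then off \<open>C \<inter> D\<close>, without affecting its value at \<open>x\<close>; two injections that agree on \<open>C \<inter> D\<close>
  become equal in this way.\<close>

lemma supports_Int:
  assumes A: "A \<in> sets" and s: "s \<in> Sorts \<Sigma>" and x: "x \<in> Carr (F\<^sub>0 A) s"
    and C: "supports A C s x" and D: "supports A D s x"
  shows "supports A (C \<inter> D) s x"
  unfolding supports_def
proof (intro ballI impI)
  fix A' f g
  assume A': "A' \<in> sets" and f: "f \<in> inj_maps A A'" and g: "g \<in> inj_maps A A'"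
    and fg: "\<forall>a\<in>A \<inter> (C \<inter> D). f a = g a"
  \<comment> \<open>A small set has a complement as large as the infinite universe, which leaves
    room for a copy of \<open>A\<close> disjoint from \<open>A'\<close>.\<close>
  have "|UNIV :: 'u set| \<le>o |- A'|"
  proof (rule ccontr)
    assume "\<not> ?thesis"
    then have "|- A'| <o |UNIV :: 'u set|" by (simp add: not_ordLeq_iff_ordLess card_of_Well_order)
    moreover have "|A'| <o |UNIV :: 'u set|" using A' by (simp add: small_def)
    ultimately have "|A' \<union> - A'| <o |UNIV :: 'u set|" using card_of_Un_ordLess_infinite[OF infinite_universe] by blast
    then show False using ordLess_irreflexive[of "|UNIV :: 'u set|"] by (simp add: Compl_partition)
  qed
  moreover have "|A| \<le>o |UNIV :: 'u set|" by (rule card_of_mono1) simp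
  ultimately have "|A| \<le>o |- A'|" using ordLeq_transitive by blast
  then obtain p where p: "inj_on p A" "p ` A \<subseteq> - A'" using card_of_ordLeq[of A "- A'"] by blast
  let ?A = "A' \<union> p ` A"
  have "|p ` A| <o |UNIV :: 'u set|"
    using A by (simp add: small_def ordLeq_ordLess_trans[OF card_of_image])
  then have "small TYPE('u) ?A"
    using A' by (simp add: small_def card_of_Un_ordLess_infinite[OF infinite_universe])
  moreover have "lam \<le>o |?A|"
    by (rule ordLeq_transitive[OF _ card_of_mono1[of A' ?A]]) (use A' in auto)
  ultimately have A'': "?A \<in> sets" by simp
  define mix where "mix = (\<lambda>P f. \<lambda>a\<in>A. if a \<in> P then f a else p a)"
  have mix: "mix P f \<in> inj_maps A ?A" if f: "f \<in> inj_maps A A'" for P f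
  proof -
    have fA: "f a \<in> A'" if "a \<in> A" for a using f that by (simp add: PiE_iff)
    have pA: "p a \<notin> A'" if "a \<in> A" for a using p(2) that by blast
    have fi: "inj_on f A" using f by simp
    have "inj_on (mix P f) A"
    proof (rule inj_onI)
      fix a b assume ab: "a \<in> A" "b \<in> A" "mix P f a = mix P f b"
      show "a = b"
        using ab fA[OF ab(1)] fA[OF ab(2)] pA[OF ab(1)] pA[OF ab(2)] inj_onD[OF fi _ ab(1,2)] inj_onD[OF p(1) _ ab(1,2)]
        by (auto simp: mix_def split: if_splits)
    qed
    then show ?thesis using fA by (auto simp: mix_def)
  qed
  \<comment> \<open>The first change is invisible on \<open>C\<close>. The second is invisible on
    \<open>D\<close>, since a point of \<open>D\<close> lies in \<open>C\<close> exactly if it lies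
    in \<open>C \<inter> D\<close>.\<close>
  have step: "F\<^sub>1 A ?A (mix A f) s x = F\<^sub>1 A ?A (mix (C \<inter> D) f) s x" if f: "f \<in> inj_maps A A'" for f
  proof -
    have "F\<^sub>1 A ?A (mix A f) s x = F\<^sub>1 A ?A (mix C f) s x"
      by (rule supportsD[OF C A'' mix[OF f] mix[OF f]]) (simp add: mix_def)
    also have "\<dots> = F\<^sub>1 A ?A (mix (C \<inter> D) f) s x"
      by (rule supportsD[OF D A'' mix[OF f] mix[OF f]]) (simp add: mix_def)
    finally show ?thesis .
  qed
  have i: "restrict id A' \<in> inj_maps A' ?A" by (rule inclusion_inj_maps) simp
  have incl: "F\<^sub>1 A' ?A (restrict id A') s (F\<^sub>1 A A' f s x) = F\<^sub>1 A ?A (mix A f) s x"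
    if f: "f \<in> inj_maps A A'" for f
  proof -
    have "compose A (restrict id A') f = mix A f"
      using f by (auto simp: compose_def mix_def fun_eq_iff PiE_iff)
    then show ?thesis using F_compose[OF A A' A'' f i s x] by simp
  qed
  have "mix (C \<inter> D) f = mix (C \<inter> D) g" using fg by (auto simp: mix_def fun_eq_iff)
  then have "F\<^sub>1 A' ?A (restrict id A') s (F\<^sub>1 A A' f s x) = F\<^sub>1 A' ?A (restrict id A') s (F\<^sub>1 A A' g s x)"
    using incl step f g by simp
  \<comment> \<open>The equality holds in the enlarged target \<open>?A\<close>; \<open>F\<close> of
    the inclusion of \<open>A'\<close> is injective, so it already holds in
    \<open>F(A')\<close>.\<close>
  then show "F\<^sub>1 A A' f s x = F\<^sub>1 A A' g s x"
    using inj_onD[OF F_inj[OF A' A'' i s]] F_carrier[OF A A' f s x] F_carrier[OF A A' g s x] by blast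
qed

text \<open>Covering over \<open>B\<close> and over \<open>B'\<close> gives the supports
  \<open>B \<union> S\<close> and \<open>B' \<union> S'\<close>. As \<open>B\<close> and
  \<open>B'\<close> are disjoint, their intersection lies in \<open>S \<union> S'\<close>, which is
  smaller than \<open>\<kappa>\<close>.\<close>

lemma small_support:
  assumes A: "A \<in> sets" and B: "B \<in> sets" "B \<subseteq> A" and B': "B' \<in> sets" "B' \<subseteq> A" and disj: "B \<inter> B' = {}"
    and s: "s \<in> Sorts \<Sigma>" and x: "x \<in> Carr (F\<^sub>0 A) s"
  obtains S where "S \<subseteq> A" "|S| <o \<kappa>" "supports A S s x"
proof -
  obtain S where S: "S \<subseteq> A" "|S| <o \<kappa>" "x \<in> im (B \<union> S) A s" using carrier_covered[OF A B s x] .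
  obtain S' where S': "S' \<subseteq> A" "|S'| <o \<kappa>" "x \<in> im (B' \<union> S') A s" using carrier_covered[OF A B' s x] .
  have "supports A (B \<union> S) s x"
    by (rule supports_im[OF A sets_between[OF B(1) A]]) (use S B s in auto)
  moreover have "supports A (B' \<union> S') s x"
    by (rule supports_im[OF A sets_between[OF B'(1) A]]) (use S' B' s in auto)
  ultimately have "supports A ((B \<union> S) \<inter> (B' \<union> S')) s x" by (rule supports_Int[OF A s x])
  then have "supports A (S \<union> S') s x" by (rule supports_mono) (use disj in auto)
  moreover have "|S \<union> S'| <o \<kappa>" by (rule Un_Cinfinite_bound_strict[OF S(2) S'(2) \<kappa>])
  ultimately show thesis using that[of "S \<union> S'"] S(1) S'(1) by blast
qed

section \<open>The submodel of elements supported in a set of size \<open>\<kappa>\<close>\<close>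

definition supported :: "'u set \<Rightarrow> 'u set \<Rightarrow> 's \<Rightarrow> 'u set" where
  "supported A E s = {x \<in> Carr (F\<^sub>0 A) s. \<exists>S\<subseteq>E. |S| <o \<kappa> \<and> supports A S s x}"

text \<open>Witnesses are moved into \<open>supported A E\<close>, keeping the parameters fixed, by an injection of \<open>A\<close> into itself.\<close>

lemma tarski_vaught_supported:
  assumes A: "A \<in> sets" and B: "B \<in> sets" "B \<subseteq> A" and B': "B' \<in> sets" "B' \<subseteq> A" and disj: "B \<inter> B' = {}"
    and E: "E \<subseteq> B" "\<kappa> \<le>o |E|" and AB': "|A| \<le>o |B'|"
  shows "tarski_vaught \<Sigma> \<kappa> (F\<^sub>0 A) (supported A E)"
  unfolding tarski_vaught_def
proof (intro conjI ballI allI impI)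
  show "supported A E s \<subseteq> Carr (F\<^sub>0 A) s" for s by (auto simp: supported_def)
next
  fix X v and \<phi> :: "('s, 'f, 'r, 'u) form"
  assume *: "L_formula \<Sigma> \<kappa> (Exi X \<phi>) \<and> (\<forall>x\<in>free_vars (Exi X \<phi>). v x \<in> supported A E (fst x)) \<and>
    sat (F\<^sub>0 A) (Exi X \<phi>) v"
  let ?V = "free_vars (Exi X \<phi>)"
  have L: "L_formula \<Sigma> \<kappa> (Exi X \<phi>)" and L': "L_formula \<Sigma> \<kappa> \<phi>"
    using * L_formula_matrix[OF \<kappa>] by blast+
  have V: "|?V| <o \<kappa>" "|X| <o \<kappa>" using L by (auto simp: L_formula_def)
  have sorts: "fst x \<in> Sorts \<Sigma>" if "x \<in> ?V \<union> X" for x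
    using L free_vars_sorts[of \<Sigma> \<kappa> "Exi X \<phi>" x] that by (auto simp: L_formula_def)
  obtain w where w: "assignment (F\<^sub>0 A) X w" "\<forall>x. x \<notin> X \<longrightarrow> w x = v x" "sat (F\<^sub>0 A) \<phi> w"
    using * unfolding sat.simps by blast
  have v: "v x \<in> Carr (F\<^sub>0 A) (fst x)" if "x \<in> ?V" for x using * that unfolding supported_def by blast
  have "\<forall>x\<in>?V. \<exists>S. S \<subseteq> E \<and> |S| <o \<kappa> \<and> supports A S (fst x) (v x)"
    using * unfolding supported_def by blast
  then obtain S where S: "\<And>x. x \<in> ?V \<Longrightarrow> S x \<subseteq> E \<and> |S x| <o \<kappa> \<and> supports A (S x) (fst x) (v x)"
    by metis
  have "\<forall>x\<in>X. \<exists>R. R \<subseteq> A \<and> |R| <o \<kappa> \<and> supports A R (fst x) (w x)"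
    using small_support[OF A B B' disj] sorts w(1) unfolding assignment_def by (metis UnI2)
  then obtain R where R: "\<And>x. x \<in> X \<Longrightarrow> R x \<subseteq> A \<and> |R x| <o \<kappa> \<and> supports A (R x) (fst x) (w x)"
    by metis
  define P where "P = (\<Union>x\<in>?V. S x)"
  define Q where "Q = (\<Union>x\<in>X. R x)"
  have P: "|P| <o \<kappa>" "P \<subseteq> E" unfolding P_def using S V by (blast intro: UN_ordLess)+
  have Q: "|Q| <o \<kappa>" "Q \<subseteq> A" unfolding Q_def using R V by (blast intro: UN_ordLess)+
  \<comment> \<open>Removing the supports \<open>P\<close> of the parameters from \<open>E\<close>
    leaves at least \<open>\<kappa>\<close> points, enough to receive a copy of the supports
    \<open>Q\<close> of the witnesses.\<close>
  have "\<kappa> \<le>o |E - P|"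
  proof (rule ccontr)
    assume "\<not> \<kappa> \<le>o |E - P|"
    moreover have "Well_order \<kappa>" using \<kappa> by (simp add: card_order_on_def)
    ultimately have "|E - P| <o \<kappa>" by (simp add: not_ordLeq_iff_ordLess card_of_Well_order)
    then have "|(E - P) \<union> P| <o \<kappa>" using Un_Cinfinite_bound_strict P(1) \<kappa> by blast
    moreover have "(E - P) \<union> P = E" using P(2) by blast
    ultimately show False using E(2) not_ordLess_ordLeq by metis
  qed
  then have "|Q| \<le>o |E - P|" by (rule ordLess_imp_ordLeq[OF ordLess_ordLeq_trans[OF Q(1)]])
  then obtain q where q: "inj_on q Q" "q ` Q \<subseteq> E - P" using card_of_ordLeq[of Q "E - P"] by blast
  obtain r where r: "inj_on r A" "r ` A \<subseteq> B'" using AB' card_of_ordLeq[of A B'] by blast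
  \<comment> \<open>Fixing \<open>P\<close> keeps the parameters fixed, and \<open>q\<close> carries
    what remains of \<open>Q\<close> into \<open>E\<close>. All other points go to
    \<open>B'\<close>, which is disjoint from \<open>E\<close>; this makes \<open>h\<close>
    injective on the whole of \<open>A\<close>.\<close>
  define h where "h = (\<lambda>a\<in>A. if a \<in> P then a else if a \<in> Q then q a else r a)"
  have EA: "E \<subseteq> A" and EB': "E \<inter> B' = {}" using E B disj by auto
  have qE: "q a \<in> E" "q a \<notin> P" if "a \<in> Q" for a using q that by auto
  have rB: "r a \<in> B'" "r a \<notin> E" if "a \<in> A" for a using r EB' that by auto
  have "inj_on h A"
  proof (rule inj_onI)
    fix a b assume ab: "a \<in> A" "b \<in> A" "h a = h b"
    show "a = b"
      using ab qE[of a] qE[of b] rB[of a] rB[of b] P(2) inj_onD[OF q(1), of a b] inj_onD[OF r(1), of a b]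
      by (auto simp: h_def split: if_splits)
  qed
  moreover have "h \<in> A \<rightarrow>\<^sub>E A" using subsetD[OF EA qE(1)] subsetD[OF B'(2) rB(1)] by (auto simp: h_def)
  ultimately have h: "h \<in> inj_maps A A" by simp
  let ?h = "F\<^sub>1 A A h"
  have hA: "?h \<in> elem (F\<^sub>0 A) (F\<^sub>0 A)" by (rule F_elem[OF A A h])
  have hv: "?h (fst x) (v x) = v x" if "x \<in> ?V" for x
  proof -
    have "?h (fst x) (v x) = F\<^sub>1 A A (restrict id A) (fst x) (v x)"
    proof (rule supportsD[OF _ A h inclusion_inj_maps])
      show "supports A (S x) (fst x) (v x)" using S that by blast
      show "h a = restrict id A a" if "a \<in> A" "a \<in> S x" for a
        using that \<open>x \<in> ?V\<close> unfolding h_def P_def by auto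
    qed simp
    also have "\<dots> = v x" using F_id[OF A _ v[OF that]] sorts that by blast
    finally show ?thesis .
  qed
  have "assignment (F\<^sub>0 A) (free_vars \<phi>) w"
    unfolding assignment_def
  proof
    fix x assume "x \<in> free_vars \<phi>"
    then show "w x \<in> Carr (F\<^sub>0 A) (fst x)"
      using w(1) w(2)[rule_format, of x] v[of x] unfolding assignment_def by (cases "x \<in> X") auto
  qed
  then have sat: "sat (F\<^sub>0 A) \<phi> (\<lambda>x. ?h (fst x) (w x))"
    using elem_sat[OF hA L'] w(3) by blast
  define w' where "w' = (\<lambda>x. if x \<in> X then ?h (fst x) (w x) else v x)"
  have "sat (F\<^sub>0 A) \<phi> w' = sat (F\<^sub>0 A) \<phi> (\<lambda>x. ?h (fst x) (w x))"
  proof (rule sat_cong)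
    fix x assume "x \<in> free_vars \<phi>"
    then show "w' x = ?h (fst x) (w x)"
      using hv[of x] w(2)[rule_format, of x] by (cases "x \<in> X") (auto simp: w'_def)
  qed
  with sat have "sat (F\<^sub>0 A) \<phi> w'" by blast
  moreover have "w' x \<in> supported A E (fst x)" if x: "x \<in> X" for x
  proof -
    have s: "fst x \<in> Sorts \<Sigma>" and wx: "w x \<in> Carr (F\<^sub>0 A) (fst x)"
      using sorts w(1) x unfolding assignment_def by auto
    have "supports A (h ` R x) (fst x) (?h (fst x) (w x))"
      by (rule supports_image[OF A s wx _ h]) (use R x in blast)
    moreover have "h ` R x \<subseteq> E" using R[OF x] x qE P(2) by (auto simp: h_def Q_def)
    moreover have "|h ` R x| <o \<kappa>" by (rule ordLeq_ordLess_trans[OF card_of_image]) (use R[OF x] in blast)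
    moreover have "?h (fst x) (w x) \<in> Carr (F\<^sub>0 A) (fst x)" by (rule F_carrier[OF A A h s wx])
    ultimately show ?thesis using x by (auto simp: supported_def w'_def)
  qed
  ultimately show "\<exists>w. (\<forall>x\<in>X. w x \<in> supported A E (fst x)) \<and> (\<forall>x. x \<notin> X \<longrightarrow> w x = v x) \<and> sat (F\<^sub>0 A) \<phi> w"
    by (intro exI[of _ w']) (simp add: w'_def)
qed

section \<open>Two disjoint sets of size \<open>lam\<close> and the contradiction\<close>

lemma disjoint_sets_exist:
  obtains B B' where "B \<in> sets" "B' \<in> sets" "B \<union> B' \<in> sets" "B \<inter> B' = {}" "|B \<union> B'| \<le>o |B'|"
proof -
  let ?U = "UNIV :: 'u set"
  have lam_inf: "infinite (Field lam)"
  proof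
    assume "finite (Field lam)"
    then have "lam <o \<kappa>" using \<kappa> lam by (intro Cfinite_ordLess_Cinfinite) (auto simp: cfinite_def)
    then show False using ordLess_transitive[OF _ \<kappa>_less_lam] ordLess_irreflexive by blast
  qed
  have "|Field lam| \<le>o |?U|"
    by (rule ordIso_ordLeq_trans[OF card_of_Field_ordIso[OF lam] ordLess_imp_ordLeq[OF lam_small]])
  then obtain c :: "'l \<Rightarrow> 'u" where c: "inj_on c (Field lam)" using card_of_ordLeq[of "Field lam" ?U] by blast
  have "|?U \<times> ?U| \<le>o |?U|" using card_of_Times_same_infinite[OF infinite_universe] by (rule ordIso_imp_ordLeq)
  then obtain p :: "'u \<times> 'u \<Rightarrow> 'u" where p: "inj p"
    using card_of_ordLeq[of "?U \<times> ?U" ?U] unfolding UNIV_Times_UNIV by blast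
  obtain a b :: 'u where ab: "a \<noteq> b" using ex_new_if_finite[OF infinite_universe, of "{undefined}"] by auto
  \<comment> \<open>\<open>B a\<close> and \<open>B b\<close> encode \<open>{a}\<close> and
    \<open>{b}\<close> times \<open>Field lam\<close> through the pairing \<open>p\<close>, so they
    are disjoint. As \<open>lam\<close> is infinite, their union still has size \<open>lam\<close>
    and is no larger than either half.\<close>
  define B where "B = (\<lambda>u. (\<lambda>z. p (u, c z)) ` Field lam)"
  have card: "|B u| =o lam" for u
  proof -
    have "inj_on (\<lambda>z. p (u, c z)) (Field lam)"
      by (rule inj_onI) (use c in \<open>simp add: inj_eq[OF p] inj_on_eq_iff\<close>)
    then have "bij_betw (\<lambda>z. p (u, c z)) (Field lam) (B u)" unfolding B_def by (rule inj_on_imp_bij_betw)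
    then have "|Field lam| =o |B u|" using card_of_ordIso by blast
    then show ?thesis by (rule ordIso_transitive[OF ordIso_symmetric card_of_Field_ordIso[OF lam]])
  qed
  have lam_le: "lam \<le>o |B u|" for u by (rule ordIso_imp_ordLeq[OF ordIso_symmetric[OF card]])
  have B: "B u \<in> sets" for u
    using lam_le ordIso_ordLess_trans[OF card lam_small] by (simp add: small_def)
  have Un: "|B a \<union> B b| \<le>o lam"
    by (rule card_of_Un_ordLeq_infinite_Field[OF lam_inf ordIso_imp_ordLeq[OF card] ordIso_imp_ordLeq[OF card] lam])
  show thesis
  proof (rule that[of "B a" "B b"])
    have "lam \<le>o |B a \<union> B b|" by (rule ordLeq_transitive[OF lam_le[of a] card_of_mono1]) simp
    then show "B a \<union> B b \<in> sets"
      using ordLeq_ordLess_trans[OF Un lam_small] by (simp add: small_def)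
    show "B a \<inter> B b = {}" using p ab by (auto simp: B_def inj_eq)
    show "|B a \<union> B b| \<le>o |B b|" by (rule ordLeq_transitive[OF Un lam_le])
  qed (rule B)+
qed

text \<open>For \<open>|E| = \<kappa>\<close>, the elements supported by \<open>E\<close> form a model \<open>F(C) \<subseteq> F(A)\<close>. Since
  \<open>|C| \<ge> lam > |E|\<close>, some transposition fixes \<open>E\<close>, hence \<open>F(C)\<close>, but not \<open>C\<close>.\<close>

lemma contradiction: False
proof -
  obtain B B' where B: "B \<in> sets" and B': "B' \<in> sets" and A: "B \<union> B' \<in> sets"
    and disj: "B \<inter> B' = {}" and le: "|B \<union> B'| \<le>o |B'|"
    using disjoint_sets_exist .
  let ?A = "B \<union> B'"
  have Field_\<kappa>: "|Field \<kappa>| =o \<kappa>" using card_of_Field_ordIso \<kappa> by blast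
  have "\<kappa> <o |B|" by (rule ordLess_ordLeq_trans[OF \<kappa>_less_lam]) (use B in simp)
  then have "|Field \<kappa>| \<le>o |B|" by (rule ordIso_ordLeq_trans[OF Field_\<kappa> ordLess_imp_ordLeq])
  then obtain E where E: "E \<subseteq> B" "|Field \<kappa>| =o |E|" using internalize_card_of_ordLeq2[of "Field \<kappa>" B] by blast
  have E\<kappa>: "\<kappa> =o |E|" by (rule ordIso_transitive[OF ordIso_symmetric[OF Field_\<kappa>] E(2)])
  have N: "tarski_vaught \<Sigma> \<kappa> (F\<^sub>0 ?A) (supported ?A E)"
    by (rule tarski_vaught_supported[OF A B _ B' _ disj E(1) ordIso_imp_ordLeq[OF E\<kappa>] le]) auto
  obtain C j where C: "C \<in> sets" and j: "j \<in> inj_maps C ?A"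
    and jE: "\<forall>s\<in>Sorts \<Sigma>. \<forall>x\<in>Carr (F\<^sub>0 C) s. F\<^sub>1 C ?A j s x \<in> supported ?A E s"
    using elementary_submodel_represented[OF A N] by (elim bexE conjE)
  have "\<not> j ` C \<subseteq> E"
  proof
    assume "j ` C \<subseteq> E"
    then have "|C| \<le>o |E|" using j card_of_ordLeq[of C E] by blast
    then have "|C| \<le>o \<kappa>" by (rule ordLeq_ordIso_trans[OF _ ordIso_symmetric[OF E\<kappa>]])
    then have "lam \<le>o \<kappa>" by (rule ordLeq_transitive[rotated]) (use C in simp)
    then show False using \<kappa>_less_lam not_ordLess_ordLeq by blast
  qed
  then obtain c where c: "c \<in> C" "j c \<notin> E" by blast
  have jc: "j c \<in> ?A" using j c by (auto simp: PiE_iff)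
  have "\<not> finite B'"
  proof
    assume "finite B'"
    then have "|B'| <o \<kappa>" using \<kappa> by (rule finite_ordLess_Cinfinite)
    then have "|B'| <o lam" by (rule ordLess_transitive[OF _ \<kappa>_less_lam])
    then show False using B' not_ordLess_ordLeq by blast
  qed
  \<comment> \<open>The partner of \<open>j c\<close> in the transposition is taken from
    \<open>B'\<close>, which keeps it outside \<open>E\<close>.\<close>
  then obtain a where a: "a \<in> B'" "a \<noteq> j c" 
    using finite_subset[of B' "{j c}"] by blast
  have aE: "a \<notin> E" using a E disj by blast
  define h where "h = (\<lambda>z\<in>?A. if z = j c then a else if z = a then j c else z)"
  have h: "h \<in> inj_maps ?A ?A" using a jc by (auto simp: h_def inj_on_def)
  \<comment> \<open>The points of \<open>C\<close> may well be sent outside \<open>E\<close>, but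
    the values of \<open>F(j)\<close> are supported in \<open>E\<close>, where \<open>h\<close> is
    the identity. So \<open>F(h)\<close> fixes these values, and faithfulness yields the
    equation.\<close>
  have "compose C h j = j"
  proof (rule F_faithful[OF C A compose_inj_maps[OF j h] j])
    fix s x assume s: "s \<in> Sorts \<Sigma>" and x: "x \<in> Carr (F\<^sub>0 C) s"
    let ?y = "F\<^sub>1 C ?A j s x"
    obtain S where S: "S \<subseteq> E" "supports ?A S s ?y" using jE s x unfolding supported_def by blast
    have "F\<^sub>1 C ?A (compose C h j) s x = F\<^sub>1 ?A ?A h s ?y" by (rule F_compose[OF C A A j h s x])
    also have "\<dots> = F\<^sub>1 ?A ?A (restrict id ?A) s ?y"
      by (rule supportsD[OF S(2) A h inclusion_inj_maps]) (use S(1) aE c(2) in \<open>auto simp: h_def\<close>)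
    also have "\<dots> = ?y" by (rule F_id[OF A s F_carrier[OF C A j s x]])
    finally show "F\<^sub>1 C ?A (compose C h j) s x = ?y" .
  qed
  then have "h (j c) = j c" using c(1) by (metis compose_eq)
  then show False using a jc by (simp add: h_def)
qed

end

theorem theorem1p2:
  fixes \<kappa> :: "'k rel" and lam :: "'l rel"
    and \<Sigma> :: "('s, 'f, 'r) signature"
    and T :: "('s, 'f, 'r, 'u) form set"
  assumes "inaccessible (univ_card TYPE('u))"
    and "Card_order lam" and "lam <o univ_card TYPE('u)"
    and "Card_order \<kappa>" and "cinfinite \<kappa>" and "regularCard \<kappa>"
    and "\<kappa> <o lam"
    and "small_signature TYPE('u) \<Sigma>"
    and "L_theory \<Sigma> \<kappa> T"
  shows "\<not> equivalent_categories
           (set_mono_cat lam :: ('u set, 'u \<Rightarrow> 'u) category)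
           (model_cat \<Sigma> \<kappa> T)"
proof
  assume eqv: "equivalent_categories
    (set_mono_cat lam :: ('u set, 'u \<Rightarrow> 'u) category) (model_cat \<Sigma> \<kappa> T)"
  \<comment> \<open>Inaccessibility puts the universe above \<open>natLeq\<close>, so it is
    infinite.\<close>
  have infinite: "infinite (UNIV :: 'u set)"
  proof
    assume "finite (UNIV :: 'u set)"
    then have "|UNIV :: 'u set| <o natLeq"
      using finite_ordLess_Cinfinite[of UNIV natLeq] natLeq_Card_order by (auto simp: cinfinite_def Field_natLeq)
    then show False
      using assms(1) ordLess_transitive ordLess_irreflexive unfolding inaccessible_def by blast
  qed
  show False
  proof (rule equivalent_categoriesE[OF eqv is_category_set_mono_cat is_category_model_cat])
    fix F\<^sub>0 :: "'u set \<Rightarrow> ('s, 'f, 'r, 'u) struct" and F\<^sub>1 :: "'u set \<Rightarrow> 'u set \<Rightarrow> ('u \<Rightarrow> 'u) \<Rightarrow> 's \<Rightarrow> 'u \<Rightarrow> 'u"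
    assume *: "is_functor (set_mono_cat lam) (model_cat \<Sigma> \<kappa> T) F\<^sub>0 F\<^sub>1"
      "\<And>A B f g. \<lbrakk>A \<in> Obj (set_mono_cat lam); B \<in> Obj (set_mono_cat lam);
        f \<in> Hom (set_mono_cat lam) A B; g \<in> Hom (set_mono_cat lam) A B; F\<^sub>1 A B f = F\<^sub>1 A B g\<rbrakk> \<Longrightarrow> f = g"
      "\<And>A B h. \<lbrakk>A \<in> Obj (set_mono_cat lam); B \<in> Obj (set_mono_cat lam);
        h \<in> Hom (model_cat \<Sigma> \<kappa> T) (F\<^sub>0 A) (F\<^sub>0 B)\<rbrakk> \<Longrightarrow> \<exists>f\<in>Hom (set_mono_cat lam) A B. F\<^sub>1 A B f = h"
      "\<And>M. M \<in> Obj (model_cat \<Sigma> \<kappa> T) \<Longrightarrow>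
        \<exists>A\<in>Obj (set_mono_cat lam). \<exists>e. is_iso (model_cat \<Sigma> \<kappa> T) (F\<^sub>0 A) M e"
    have "sets_as_models \<kappa> lam \<Sigma> T F\<^sub>0 F\<^sub>1"
      by (rule sets_as_models.intro[OF infinite _ assms(6,2,7,3,8,9) *]) (simp add: assms(4,5))
    then show False by (rule sets_as_models.contradiction)
  qed
qed

end
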